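(* Every finite $2$-connected graph $G$ has the strong $\mathcal{F}_3$ property: for any three distinct vertices $x_1, x_2, x_3$ of $G$ and any given $i \in \{1,2\}$, there is a hamiltonian path in $G^2$ from $x_1$ to $x_2$ which contains two distinct edges $x_3z_3$ and $x_iz_i$ of $G$ (for some $z_3, z_i \in V(G)$).
   Context: All graphs are finite and simple. The square $G^2$ of $G$ is the graph on $V(G)$ in which two distinct vertices are adjacent iff their distance in $G$ is at most $2$; thus $E(G)\subseteq E(G^2)$. *)

theory Defs
  imports "Graph_Theory.Graph_Theory"
begin

text \<open>
  A finite simple graph is a \<^locale>\<open>pair_graph\<close>: a finite, loop-free, symmetric set of arcs,
  in which an undirected edge \<open>uv\<close> is the pair of arcs \<open>(u, v)\<close> and \<open>(v, u)\<close>.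
\<close>

definition k_connected :: "nat \<Rightarrow> 'a pair_pre_digraph \<Rightarrow> bool" where
  "k_connected k G \<longleftrightarrow>
     k < card (pverts G) \<and>
     (\<forall>X \<subseteq> pverts G. card X < k \<longrightarrow>
        Digraph_Component.connected (with_proj G \<restriction> (pverts G - X)))"

text \<open>With unit arc weights, \<^const>\<open>wf_digraph.\<mu>\<close> is the usual graph distance (infinite if
  there is no walk).\<close>

definition graph_dist :: "'a pair_pre_digraph \<Rightarrow> 'a \<Rightarrow> 'a \<Rightarrow> ereal" where
  "graph_dist G u v = wf_digraph.\<mu> (with_proj G) (\<lambda>_. 1) u v"

definition square :: "'a pair_pre_digraph \<Rightarrow> 'a pair_pre_digraph" where
  "square G =
     \<lparr> pverts = pverts G,
       parcs = {(u, v). u \<in> pverts G \<and> v \<in> pverts G \<and> u \<noteq> v \<and> graph_dist G u v \<le> 2} \<rparr>"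

definition hamiltonian_path ::
    "'a pair_pre_digraph \<Rightarrow> 'a \<Rightarrow> ('a \<times> 'a) awalk \<Rightarrow> 'a \<Rightarrow> bool" where
  "hamiltonian_path G u p v \<longleftrightarrow>
     pre_digraph.apath (with_proj G) u p v \<and>
     set (pre_digraph.awalk_verts (with_proj G) u p) = pverts G"

text \<open>The undirected edges traversed by a walk, forgetting the direction of traversal.\<close>

definition path_edges :: "('a \<times> 'a) awalk \<Rightarrow> 'a set set" where
  "path_edges p = (\<lambda>(u, v). {u, v}) ` set p"

definition strong_F3 :: "'a pair_pre_digraph \<Rightarrow> bool" where
  "strong_F3 G \<longleftrightarrow>
     (\<forall>x :: nat \<Rightarrow> 'a. x ` {1, 2, 3} \<subseteq> pverts G \<and> inj_on x {1, 2, 3} \<longrightarrow>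
       (\<forall>i \<in> {1, 2}. \<exists>p z3 zi.
          hamiltonian_path (square G) (x 1) p (x 2) \<and>
          (x 3, z3) \<in> parcs G \<and> (x i, zi) \<in> parcs G \<and>
          {x 3, z3} \<noteq> {x i, zi} \<and>
          {x 3, z3} \<in> path_edges p \<and> {x i, zi} \<in> path_edges p))"

end

theory Submission
  imports Defs "HOL-Library.Multiset" "HOL-Library.Sublist"
begin

text \<open>
  Write \<open>s = x\<^sub>i\<close>, let \<open>z\<close> be the other one of \<open>x\<^sub>1, x\<^sub>2\<close>, and let \<open>X\<close> be the neighbourhood of \<open>s\<close>. The
  theorem follows from a statement about a vertex set \<open>W\<close> (\<open>route_with_edge\<close>): if after the deletion of
  any vertex every remaining vertex of \<open>W\<close> still reaches \<open>z\<close> or \<open>X\<close>, then \<open>W\<close> can be listed from \<open>X\<close>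
  to \<open>z\<close>, with consecutive vertices at distance at most 2 or both in \<open>X\<close>, and with an edge of the graph
  at a prescribed vertex \<open>t\<close>. The induction on \<open>card W\<close> either splits \<open>W\<close> at \<open>t\<close> and a neighbour of \<open>t\<close>,
  or removes a path \<open>q\<^sub>1, \<dots>, q\<^sub>m = z\<close> that misses \<open>t\<close> and a neighbour of it. In the latter case the lists
  of the components of the rest are broken into pieces running between neighbourhoods of path vertices.
  The pieces are the edges of a multigraph on the labels \<open>0, \<dots>, m + 1\<close>, where \<open>0\<close> stands for \<open>X\<close>; each
  \<open>q\<^sub>k\<close> is one more edge, whose ends may be chosen among \<open>k - 1, k, k + 1\<close>. The choice is made such that
  the multigraph has an Euler trail, and the pieces are concatenated along it.
\<close>

section \<open>Pieces and Euler trails\<close>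

text \<open>A piece is an edge of a multigraph that carries a list.\<close>

datatype ('l, 'a) piece = Piece (source: 'l) (content: "'a list") (target: 'l)

definition flip :: "('l, 'a) piece \<Rightarrow> ('l, 'a) piece" where
  "flip p = Piece (target p) (rev (content p)) (source p)"

definition reoriented :: "('l, 'a) piece multiset \<Rightarrow> ('l, 'a) piece multiset \<Rightarrow> bool" where
  "reoriented = rel_mset (\<lambda>p q. q = p \<or> q = flip p)"

definition labels :: "('l, 'a) piece multiset \<Rightarrow> 'l set" where
  "labels M = (\<Union>p\<in>set_mset M. {source p, target p})"

definition deg :: "'l \<Rightarrow> ('l, 'a) piece multiset \<Rightarrow> nat" where
  "deg l M = (\<Sum>p\<in>#M. of_bool (source p = l) + of_bool (target p = l))"

definition contents :: "('l, 'a) piece multiset \<Rightarrow> 'a multiset" where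
  "contents M = (\<Sum>p\<in>#M. mset (content p))"

definition glue :: "('l, 'a) piece list \<Rightarrow> 'a list" where
  "glue ps = concat (map content ps)"

definition closed_under :: "('l, 'a) piece multiset \<Rightarrow> 'l set \<Rightarrow> bool" where
  "closed_under M X \<longleftrightarrow> (\<forall>p\<in>#M. source p \<in> X \<longleftrightarrow> target p \<in> X)"

definition connects :: "('l, 'a) piece multiset \<Rightarrow> 'l set \<Rightarrow> bool" where
  "connects M L \<longleftrightarrow> (\<forall>X. closed_under M X \<longrightarrow> L \<subseteq> X \<or> L \<inter> X = {})"

fun trail :: "'l \<Rightarrow> ('l, 'a) piece list \<Rightarrow> 'l \<Rightarrow> bool" where
  "trail a [] b \<longleftrightarrow> a = b"
| "trail a (p # ps) b \<longleftrightarrow> source p = a \<and> trail (target p) ps b"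

lemma flip_simps [simp]:
  "flip (flip p) = p" "source (flip p) = target p" "target (flip p) = source p"
  "content (flip p) = rev (content p)"
  by (simp_all add: flip_def)

lemma labels_simps [simp]:
  "labels {#} = {}"
  "labels (add_mset p M) = {source p, target p} \<union> labels M"
  "labels (M + N) = labels M \<union> labels N"
  by (auto simp: labels_def)

lemma deg_simps [simp]:
  "deg l {#} = 0"
  "deg l (add_mset p M) = of_bool (source p = l) + of_bool (target p = l) + deg l M"
  "deg l (M + N) = deg l M + deg l N"
  by (simp_all add: deg_def)

lemma contents_simps [simp]:
  "contents {#} = {#}"
  "contents (add_mset p M) = mset (content p) + contents M"
  "contents (M + N) = contents M + contents N"
  by (simp_all add: contents_def)

lemma glue_simps [simp]:
  "glue [] = []"
  "glue (p # ps) = content p @ glue ps"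
  "glue (ps @ qs) = glue ps @ glue qs"
  by (simp_all add: glue_def)

lemma closed_under_simps [simp]:
  "closed_under {#} X"
  "closed_under (add_mset p M) X \<longleftrightarrow> (source p \<in> X \<longleftrightarrow> target p \<in> X) \<and> closed_under M X"
  "closed_under (M + N) X \<longleftrightarrow> closed_under M X \<and> closed_under N X"
  by (auto simp: closed_under_def)

lemma deg_eq_0_iff: "deg l M = 0 \<longleftrightarrow> l \<notin> labels M"
  by (induction M) auto

lemma label_if_odd_deg: "odd (deg l M) \<Longrightarrow> l \<in> labels M"
  using deg_eq_0_iff[of l M] by (cases "l \<in> labels M") simp_all

lemma contents_mset: "contents (mset ps) = mset (glue ps)"
  by (induction ps) auto

lemma sublist_glue: "p \<in> set ps \<Longrightarrow> sublist (content p) (glue ps)"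
  by (auto simp: glue_def dest!: split_list)

lemma closed_under_Compl: "closed_under M X \<Longrightarrow> closed_under M (- X)"
  by (auto simp: closed_under_def)

lemma closed_under_Int: "closed_under M X \<Longrightarrow> closed_under M Y \<Longrightarrow> closed_under M (X \<inter> Y)"
  by (auto simp: closed_under_def)

lemma closed_under_if_labels_subset: "labels M \<subseteq> X \<Longrightarrow> closed_under M X"
  by (auto simp: closed_under_def labels_def)

lemma closed_under_if_labels_disjoint: "labels M \<inter> X = {} \<Longrightarrow> closed_under M X"
  by (auto simp: closed_under_def labels_def)

lemma even_sum_deg_if_closed_under:
  assumes "finite X" "closed_under M X"
  shows "even (\<Sum>l\<in>X. deg l M)"
  using assms(2)
proof (induction M)
  case (add p M)
  have "(\<Sum>l\<in>X. of_bool (k = l)) = (of_bool (k \<in> X) :: nat)" for k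
    using assms(1) sum.delta[of X k "\<lambda>_. 1 :: nat"] by (simp add: of_bool_def)
  then show ?case
    using add by (auto simp: sum.distrib)
qed simp

lemma connects_subset: "connects M L \<Longrightarrow> L' \<subseteq> L \<Longrightarrow> connects M L'"
  unfolding connects_def by blast

lemma connects_mono: "connects N L \<Longrightarrow> N \<subseteq># M \<Longrightarrow> connects M L"
  unfolding connects_def closed_under_def by (metis mset_subset_eqD)

lemma connects_insert_piece:
  "connects M L \<Longrightarrow> p \<in># M \<Longrightarrow> source p \<in> L \<or> target p \<in> L \<Longrightarrow> connects M ({source p, target p} \<union> L)"
  unfolding connects_def closed_under_def by blast

lemma connects_Un:
  "connects M L \<Longrightarrow> connects M L' \<Longrightarrow> L \<inter> L' \<noteq> {} \<Longrightarrow> connects M (L \<union> L')"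
  unfolding connects_def by blast

lemma label_if_connects: "connects M L \<Longrightarrow> l \<in> L \<Longrightarrow> l' \<in> L \<Longrightarrow> l \<noteq> l' \<Longrightarrow> l \<in> labels M"
  using closed_under_if_labels_disjoint[of M "{l}"] unfolding connects_def by blast

lemma reoriented_refl [simp]: "reoriented M M"
  unfolding reoriented_def by (rule multiset.rel_refl) simp

lemma reoriented_add_mset:
  "reoriented M N \<Longrightarrow> q = p \<or> q = flip p \<Longrightarrow> reoriented (add_mset p M) (add_mset q N)"
  by (simp add: reoriented_def rel_mset_Plus)

lemma reoriented_induct [consumes 1, case_names empty keep flip]:
  assumes "reoriented M N" and "P {#} {#}"
    and "\<And>p M N. reoriented M N \<Longrightarrow> P M N \<Longrightarrow> P (add_mset p M) (add_mset p N)"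
    and "\<And>p M N. reoriented M N \<Longrightarrow> P M N \<Longrightarrow> P (add_mset p M) (add_mset (flip p) N)"
  shows "P M N"
proof -
  have "rel_mset R M N \<Longrightarrow> R = (\<lambda>p q. q = p \<or> q = flip p) \<Longrightarrow> P M N" for R
  proof (induction rule: rel_mset_induct)
    case (add R p q M N)
    then show ?case using assms(3,4) by (auto simp: reoriented_def)
  qed (use assms(2) in simp)
  then show ?thesis
    using assms(1) by (simp add: reoriented_def)
qed

lemma reoriented_add:
  "reoriented M M' \<Longrightarrow> reoriented N N' \<Longrightarrow> reoriented (M + N) (M' + N')"
  by (induction rule: reoriented_induct) (simp_all add: reoriented_add_mset)

lemma reoriented_sym: "reoriented M N \<Longrightarrow> reoriented N M"
  by (induction rule: reoriented_induct) (simp_all add: reoriented_add_mset)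

lemma reoriented_flips: "reoriented (mset ps) (mset (map flip ps))"
  by (induction ps) (simp_all add: reoriented_add_mset)

lemma
  assumes "reoriented M N"
  shows reoriented_labels: "labels N = labels M" and reoriented_deg: "deg l N = deg l M"
    and reoriented_contents: "contents N = contents M" and reoriented_size: "size N = size M"
  using assms by (induction rule: reoriented_induct) (simp_all add: insert_commute)

lemma reoriented_closed_under: "reoriented M N \<Longrightarrow> closed_under N X \<longleftrightarrow> closed_under M X"
  by (induction rule: reoriented_induct) auto

lemma reoriented_memberD: "reoriented M N \<Longrightarrow> p \<in># M \<Longrightarrow> p \<in># N \<or> flip p \<in># N"
  by (induction rule: reoriented_induct) auto

lemma reoriented_add_msetE:
  assumes "reoriented (add_mset p M) M'"
  obtains q N where "M' = add_mset q N" "q = p \<or> q = flip p" "reoriented M N"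
  using msed_rel_invL[OF assms[unfolded reoriented_def]] that by (auto simp: reoriented_def)

lemma reoriented_trans: "reoriented L M \<Longrightarrow> reoriented M N \<Longrightarrow> reoriented L N"
proof (induction arbitrary: N rule: reoriented_induct)
  case (keep p L M)
  from keep.prems obtain r N' where "N = add_mset r N'" "r = p \<or> r = flip p" "reoriented M N'"
    by (rule reoriented_add_msetE)
  then show ?case using keep.IH by (simp add: reoriented_add_mset)
next
  case (flip p L M)
  from flip.prems obtain r N' where "N = add_mset r N'" "r = flip p \<or> r = p" "reoriented M N'"
    by (rule reoriented_add_msetE) simp
  then show ?case using flip.IH by (auto simp: reoriented_add_mset)
qed simp

lemma trail_append: "trail a (ps @ qs) b \<longleftrightarrow> (\<exists>c. trail a ps c \<and> trail c qs b)"
  by (induction ps arbitrary: a) auto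

lemma trail_rev: "trail a ps b \<Longrightarrow> trail b (rev (map flip ps)) a"
  by (induction ps arbitrary: a) (auto simp: trail_append)

lemma even_deg_trail: "trail a ps b \<Longrightarrow> even (deg l (mset ps) + of_bool (l = a) + of_bool (l = b))"
proof (induction ps arbitrary: a)
  case (Cons p ps)
  then show ?case
    using Cons.IH[of "target p"] by (cases "l = a"; cases "l = target p") auto
qed auto

lemma trail_split:
  assumes "trail a ps b" "l \<in> labels (mset ps)"
  obtains us vs where "ps = us @ vs" "trail a us l" "trail l vs b"
proof -
  obtain p where "p \<in> set ps" and l: "l = source p \<or> l = target p"
    using assms(2) by (auto simp: labels_def)
  then obtain us vs where ps: "ps = us @ p # vs"
    by (meson split_list)
  then have "trail a us (source p)" "trail (target p) vs b"
    using assms(1) by (auto simp: trail_append)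
  then show ?thesis
    using l that[of us "p # vs"] that[of "us @ [p]" vs] by (auto simp: ps trail_append)
qed

definition partial_trail ::
    "('l, 'a) piece multiset \<Rightarrow> 'l \<Rightarrow> ('l, 'a) piece list \<Rightarrow> 'l \<Rightarrow> ('l, 'a) piece multiset \<Rightarrow> bool" where
  "partial_trail M a ps b R \<longleftrightarrow> trail a ps b \<and> reoriented M (mset ps + R)"

lemma partial_trail_extend:
  assumes "partial_trail M a ps b R" "b \<in> labels R"
  obtains p c R' where "partial_trail M a (ps @ [p]) c R'"
proof -
  obtain p where p: "p \<in># R" "b = source p \<or> b = target p"
    using assms(2) by (auto simp: labels_def)
  obtain R' where R: "R = add_mset p R'"
    using p(1) by (metis insert_DiffM)
  define q where "q = (if b = source p then p else flip p)"
  have "trail a (ps @ [q]) (target q)"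
    using assms(1) p(2) by (auto simp: partial_trail_def trail_append q_def)
  moreover have "reoriented {#p#} {#q#}"
    by (simp add: q_def reoriented_add_mset)
  then have "reoriented (mset ps + R) (mset (ps @ [q]) + R')"
    using reoriented_add[of "{#p#}" "{#q#}" "mset ps + R'"] by (simp add: R)
  then have "reoriented M (mset (ps @ [q]) + R')"
    using assms(1) reoriented_trans unfolding partial_trail_def by metis
  ultimately show ?thesis
    using that by (simp add: partial_trail_def)
qed

lemma partial_trail_rotate:
  assumes "partial_trail M a ps a R" "l \<in> labels (mset ps)"
  obtains qs where "partial_trail M l qs l R" "length qs = length ps"
proof -
  obtain us vs where "ps = us @ vs" "trail a us l" "trail l vs a"
    using trail_split assms by (metis partial_trail_def)
  then show ?thesis
    using that[of "vs @ us"] assms(1) by (auto simp: partial_trail_def trail_append union_commute)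
qed

lemma longest_partial_trail:
  fixes M :: "('l, 'a) piece multiset"
  obtains a ps b R where "partial_trail M a ps b R"
    "\<forall>a' ps' b' R'. partial_trail M a' ps' b' R' \<longrightarrow> length ps' \<le> length ps"
proof -
  define P where "P n \<longleftrightarrow> (\<exists>a ps b R. partial_trail M a ps b R \<and> length ps = n)" for n
  have "partial_trail M a [] a M" for a
    by (simp add: partial_trail_def)
  then have "P 0"
    unfolding P_def by fastforce
  moreover have "n \<le> size M" if "P n" for n
    using that reoriented_size by (fastforce simp: P_def partial_trail_def)
  ultimately obtain n where "P n" and greatest: "\<And>k. P k \<Longrightarrow> k \<le> n"
    by (metis GreatestI_nat Greatest_le_nat)
  then obtain a ps b R where "partial_trail M a ps b R" "length ps = n"
    by (auto simp: P_def)
  moreover have "length ps' \<le> n" if "partial_trail M a' ps' b' R'" for a' ps' b' R'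
    using that greatest[of "length ps'"] unfolding P_def by blast
  ultimately show ?thesis
    using that by blast
qed

lemma labels_meet_if_connects:
  assumes "connects (M + N) (labels (M + N))" "M \<noteq> {#}" "N \<noteq> {#}"
  shows "labels M \<inter> labels N \<noteq> {}"
proof
  assume "labels M \<inter> labels N = {}"
  moreover from this have "closed_under (M + N) (labels M)"
    by (auto intro: closed_under_if_labels_subset closed_under_if_labels_disjoint)
  ultimately have "labels M = {} \<or> labels N = {}"
    using assms(1) unfolding connects_def by force
  then show False
    using assms(2,3) by (auto simp: labels_def)
qed

lemma partial_trail_rotate_to_rest:
  assumes "partial_trail M a ps a R" "connects M (labels M)" "R \<noteq> {#}"
  obtains l qs where "partial_trail M l qs l R" "length qs = length ps" "l \<in> labels R"
proof (cases "ps = []")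
  case True
  then have "partial_trail M l [] l R" for l
    using assms(1) by (simp add: partial_trail_def)
  moreover have "labels R \<noteq> {}"
    using assms(3) by (auto simp: labels_def)
  ultimately show ?thesis
    using that True by auto
next
  case False
  have reoriented: "reoriented M (mset ps + R)"
    using assms(1) by (simp add: partial_trail_def)
  have "connects (mset ps + R) (labels (mset ps + R))"
    using assms(2) reoriented_labels[OF reoriented] reoriented_closed_under[OF reoriented]
    by (simp add: connects_def)
  then obtain l where "l \<in> labels (mset ps)" "l \<in> labels R"
    using labels_meet_if_connects[of "mset ps" R] False assms(3) by auto
  then show ?thesis
    using that partial_trail_rotate[OF assms(1)] by metis
qed

text \<open>A longest trail is closed, because an open one can be prolonged by parity; if it missed a
  piece, it could be rotated to start at a label of a missed piece and then be prolonged.\<close>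

lemma Euler_closed:
  assumes even_deg: "\<And>l. even (deg l M)" and connects: "connects M (labels M)"
  obtains a ps where "trail a ps a" "reoriented M (mset ps)"
proof -
  obtain a ps b R where ps: "partial_trail M a ps b R"
    and longest: "\<forall>a' ps' b' R'. partial_trail M a' ps' b' R' \<longrightarrow> length ps' \<le> length ps"
    by (rule longest_partial_trail)
  have trail: "trail a ps b" and reoriented: "reoriented M (mset ps + R)"
    using ps by (simp_all add: partial_trail_def)
  have stuck: "c \<notin> labels R" if "partial_trail M d qs c R" "length qs = length ps" for d qs c
  proof
    assume "c \<in> labels R"
    with that(1) obtain p c' R' where "partial_trail M d (qs @ [p]) c' R'"
      by (rule partial_trail_extend)
    then have "length (qs @ [p]) \<le> length ps"
      using longest by blast
    then show False using that(2) by simp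
  qed
  have "even (deg b (mset ps))"
    using even_deg[of b] reoriented_deg[OF reoriented, of b] stuck[OF ps] deg_eq_0_iff[of b R]
    by simp
  then have "a = b"
    using even_deg_trail[OF trail, of b] by (cases "a = b") auto
  moreover from this have "R = {#}"
    using partial_trail_rotate_to_rest[OF _ connects] ps stuck by metis
  ultimately show ?thesis
    using that trail reoriented by simp
qed

lemma Euler_open:
  fixes M :: "('l, 'a) piece multiset"
  assumes even_deg: "\<And>l. l \<notin> {a, b} \<Longrightarrow> even (deg l M)"
    and odd_deg: "odd (deg a M)" "odd (deg b M)" and "connects M (labels M)" and "a \<noteq> b"
  obtains ps where "trail a ps b" "reoriented M (mset ps)"
proof -
  define d :: "('l, 'a) piece" where "d = Piece b [] a"
  have "even (deg l (add_mset d M))" for l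
    using even_deg[of l] odd_deg \<open>a \<noteq> b\<close> by (auto simp: d_def)
  moreover have "labels (add_mset d M) = labels M"
    using odd_deg[THEN label_if_odd_deg] by (auto simp: d_def)
  then have "connects (add_mset d M) (labels (add_mset d M))"
    using assms(4) by (simp add: connects_def)
  ultimately obtain c ps where ps: "trail c ps c" "reoriented (add_mset d M) (mset ps)"
    by (rule Euler_closed)
  obtain q Q where q: "mset ps = add_mset q Q" "q = d \<or> q = flip d" "reoriented M Q"
    using ps(2) by (rule reoriented_add_msetE)
  then obtain us vs where uv: "ps = us @ q # vs"
    by (metis ex_mset in_set_conv_decomp set_mset_mset union_single_eq_member)
  have reoriented: "reoriented M (mset (vs @ us))"
    using q(1,3) by (simp add: uv add.commute)
  have trail: "trail (target q) (vs @ us) (source q)"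
    using ps(1) by (auto simp: uv trail_append)
  from q(2) show ?thesis
  proof
    assume "q = d"
    then show ?thesis using that trail reoriented by (simp add: d_def)
  next
    assume "q = flip d"
    then have "trail a (rev (map flip (vs @ us))) b"
      using trail_rev[OF trail] by (simp add: d_def)
    moreover have "reoriented M (mset (rev (map flip (vs @ us))))"
      using reoriented_trans[OF reoriented reoriented_flips] by (simp only: mset_rev)
    ultimately show ?thesis by (rule that)
  qed
qed

lemma even_deg_iff_even_deg:
  assumes "\<And>l. l \<notin> {a, b} \<Longrightarrow> even (deg l M)" "a \<noteq> b"
  shows "even (deg a M) \<longleftrightarrow> even (deg b M)"
proof -
  let ?L = "labels M \<union> {a, b}"
  have "finite ?L"
    by (simp add: labels_def)
  then have "even (\<Sum>l\<in>?L. deg l M)"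
    by (intro even_sum_deg_if_closed_under closed_under_if_labels_subset) auto
  moreover have "(\<Sum>l\<in>?L. deg l M) = (\<Sum>l\<in>?L - {a, b}. deg l M) + (\<Sum>l\<in>{a, b}. deg l M)"
    using \<open>finite ?L\<close> by (intro sum.subset_diff) auto
  moreover have "even (\<Sum>l\<in>?L - {a, b}. deg l M)"
    using assms(1) by (intro dvd_sum) blast
  ultimately show ?thesis
    using assms(2) by simp
qed

lemma Euler_trails_between:
  fixes M :: "('l, 'a) piece multiset"
  assumes even_deg: "\<And>l. l \<notin> {a, b} \<Longrightarrow> even (deg l M)" and "connects M (labels M)"
    and ab: "a \<in> labels M" "b \<in> labels M" "a \<noteq> b"
  obtains pss where "pss \<noteq> []" "\<And>ps. ps \<in> set pss \<Longrightarrow> trail a ps b" "reoriented M (mset (concat pss))"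
    "odd (deg a M) \<Longrightarrow> length pss = 1"
proof (cases "odd (deg a M)")
  case True
  then have "odd (deg b M)"
    using even_deg_iff_even_deg[OF even_deg ab(3)] by blast
  then obtain ps where "trail a ps b" "reoriented M (mset ps)"
    using Euler_open[OF even_deg] True assms(2) ab(3) by metis
  then show ?thesis using that[of "[ps]"] by simp
next
  case False
  then have "even (deg b M)"
    using even_deg_iff_even_deg[OF even_deg ab(3)] by blast
  then have "even (deg l M)" for l
    using even_deg[of l] False by auto
  then obtain c ps where ps: "trail c ps c" "reoriented M (mset ps)"
    using Euler_closed assms(2) by metis
  have "partial_trail M c ps c {#}"
    using ps by (simp add: partial_trail_def)
  then obtain qs where qs: "trail a qs a" "reoriented M (mset qs)"
    using partial_trail_rotate[of M c ps "{#}" a] ab(1) reoriented_labels[OF ps(2)]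
    by (auto simp: partial_trail_def)
  then obtain us vs where uv: "qs = us @ vs" "trail a us b" "trail b vs a"
    using trail_split[OF qs(1), of b] ab(2) reoriented_labels[OF qs(2)] by auto
  have "reoriented (mset us + mset vs) (mset us + mset (map flip vs))"
    by (intro reoriented_add reoriented_refl reoriented_flips)
  then have "reoriented M (mset (concat [us, rev (map flip vs)]))"
    using reoriented_trans[of M "mset us + mset vs"] qs(2) by (simp add: uv(1))
  then show ?thesis
    using that[of "[us, rev (map flip vs)]"] uv(2) trail_rev[OF uv(3)] False by auto
qed

section \<open>Choosing the labels of the path vertices\<close>

text \<open>Every vertex \<open>q k\<close> of a path becomes a piece of its own, whose labels belong to path vertices
  at distance at most one from \<open>q k\<close>.\<close>

definition spine :: "(nat \<Rightarrow> 'a) \<Rightarrow> nat set \<Rightarrow> (nat, 'a) piece multiset \<Rightarrow> bool" where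
  "spine q K Q \<longleftrightarrow> contents Q = image_mset q (mset_set K) \<and>
     (\<forall>p\<in>#Q. \<exists>k\<in>K. content p = [q k] \<and> source p \<in> {k - 1..k + 1} \<and> target p \<in> {k - 1..k + 1})"

definition Eulerian_spine ::
    "(nat \<Rightarrow> 'a) \<Rightarrow> nat \<Rightarrow> (nat, 'a) piece multiset \<Rightarrow> (nat, 'a) piece multiset \<Rightarrow> bool" where
  "Eulerian_spine q m M Q \<longleftrightarrow> spine q {1..m} Q \<and> (\<forall>l\<in>{1..m}. even (deg l (M + Q))) \<and>
     connects (M + Q) {..m + 1}"

definition relabel :: "('l \<Rightarrow> 'k) \<Rightarrow> ('l, 'a) piece multiset \<Rightarrow> ('k, 'a) piece multiset" where
  "relabel f M = {#Piece (f (source p)) (content p) (f (target p)). p \<in># M#}"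

lemma spine_empty [simp]: "spine q {} {#}"
  by (simp add: spine_def)

lemma spine_single:
  "x \<in> {k - 1..k + 1} \<Longrightarrow> y \<in> {k - 1..k + 1} \<Longrightarrow> spine q {k} {#Piece x [q k] y#}"
  by (simp add: spine_def)

lemma spine_Un:
  assumes "spine q K Q" "spine q K' Q'" "finite K" "finite K'" "K \<inter> K' = {}"
  shows "spine q (K \<union> K') (Q + Q')"
  using assms unfolding spine_def by (simp add: mset_set_Union) blast

lemma spine_memberE:
  assumes "spine q K Q" "p \<in># Q"
  obtains k where "k \<in> K" "content p = [q k]" "source p \<in> {k - 1..k + 1}" "target p \<in> {k - 1..k + 1}"
  using assms unfolding spine_def by blast

lemma labels_spine: "spine q {1..m} Q \<Longrightarrow> labels Q \<subseteq> {..m + 1}"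
  unfolding labels_def by (fastforce elim: spine_memberE)

lemma labels_Eulerian_spine:
  assumes "Eulerian_spine q m M Q" "labels M \<subseteq> {..m + 1}"
  shows "labels (M + Q) = {..m + 1}"
proof
  show "labels (M + Q) \<subseteq> {..m + 1}"
    using assms labels_spine[of q m Q] by (simp add: Eulerian_spine_def)
  have connects: "connects (M + Q) {..m + 1}"
    using assms(1) by (simp add: Eulerian_spine_def)
  show "{..m + 1} \<subseteq> labels (M + Q)"
  proof
    fix l assume "l \<in> {..m + 1}"
    then show "l \<in> labels (M + Q)"
      using label_if_connects[OF connects, of l "if l = 0 then m + 1 else 0"] by auto
  qed
qed

lemma even_deg_Eulerian_spine:
  assumes "Eulerian_spine q m M Q" "labels M \<subseteq> {..m + 1}" "l \<notin> {0, m + 1}"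
  shows "even (deg l (M + Q))"
proof (cases "l \<in> {1..m}")
  case True
  then show ?thesis using assms(1) unfolding Eulerian_spine_def by blast
next
  case False
  then have "l \<notin> labels (M + Q)"
    unfolding labels_Eulerian_spine[OF assms(1,2)] using assms(3) by auto
  then have "deg l (M + Q) = 0"
    by (subst deg_eq_0_iff)
  then show ?thesis by (simp only: even_zero)
qed

lemma contents_relabel [simp]: "contents (relabel f M) = contents M"
  by (induction M) (simp_all add: relabel_def)

lemma labels_relabel [simp]: "labels (relabel f M) = f ` labels M"
  by (induction M) (simp_all add: relabel_def)

lemma closed_under_relabel [simp]: "closed_under (relabel f M) X \<longleftrightarrow> closed_under M (f -` X)"
  by (induction M) (simp_all add: relabel_def)

lemma deg_relabel:
  assumes "inj_on f A" "labels M \<subseteq> A" "l \<in> A"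
  shows "deg (f l) (relabel f M) = deg l M"
  using assms(2)
proof (induction M)
  case (add p M)
  then show ?case
    using assms(1,3) by (simp add: relabel_def inj_on_eq_iff)
qed (simp add: relabel_def)

lemma connects_relabel: "connects M L \<Longrightarrow> connects (relabel f M) (f ` L)"
  unfolding connects_def by (simp add: subset_vimage_iff[symmetric] image_subset_iff_subset_vimage) blast

lemma spine_reflect:
  assumes "spine (\<lambda>k. q (n - k)) K Q" "K \<subseteq> {..n}"
  shows "spine q ((\<lambda>k. n - k) ` K) (relabel (\<lambda>l. n - l) Q)"
  unfolding spine_def
proof (intro conjI ballI)
  have "inj_on (\<lambda>k. n - k) K"
    by (rule inj_on_subset[OF _ assms(2)]) (auto simp: inj_on_def)
  then have "mset_set ((\<lambda>k. n - k) ` K) = image_mset (\<lambda>k. n - k) (mset_set K)"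
    by (simp add: image_mset_mset_set)
  then show "contents (relabel (\<lambda>l. n - l) Q) = image_mset q (mset_set ((\<lambda>k. n - k) ` K))"
    using assms(1) by (simp add: spine_def image_mset.compositionality comp_def)
next
  fix p assume "p \<in># relabel (\<lambda>l. n - l) Q"
  then obtain r where r: "r \<in># Q" "p = Piece (n - source r) (content r) (n - target r)"
    by (auto simp: relabel_def)
  obtain k where "k \<in> K" "content r = [q (n - k)]" "source r \<in> {k - 1..k + 1}" "target r \<in> {k - 1..k + 1}"
    using assms(1) r(1) by (rule spine_memberE)
  then show "\<exists>k\<in>(\<lambda>k. n - k) ` K. content p = [q k] \<and> source p \<in> {k - 1..k + 1} \<and> target p \<in> {k - 1..k + 1}"
    by (intro bexI[of _ "n - k"]) (auto simp: r(2))
qed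

lemma connects_bridge:
  assumes "connects M A" "connects M B" "labels M \<subseteq> A \<union> B" "\<not> closed_under M A"
  shows "connects M (A \<union> B)"
proof -
  have separated: False if X: "closed_under M X" "A \<subseteq> X" "B \<inter> X = {}" for X
  proof -
    have "l \<in> X \<longleftrightarrow> l \<in> A" if "l \<in> labels M" for l
      using that X(2,3) assms(3) by blast
    then have "closed_under M A"
      using X(1) by (auto simp: closed_under_def labels_def)
    then show False using assms(4) by simp
  qed
  show ?thesis
    unfolding connects_def
  proof (intro allI impI)
    fix X assume X: "closed_under M X"
    have "\<not> (A \<inter> X = {} \<and> B \<subseteq> X)"
      using separated[OF closed_under_Compl[OF X]] by blast
    then show "A \<union> B \<subseteq> X \<or> (A \<union> B) \<inter> X = {}"
      using assms(1,2) X separated[OF X] unfolding connects_def by blast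
  qed
qed

lemma connects_insert_odd:
  assumes "connects (M + N) B" and "odd (deg l M)" "closed_under M C" "finite C" "l \<in> C" "C \<subseteq> insert l B"
  shows "connects (M + N) (insert l B)"
proof -
  have separated: False if "closed_under M X" "C \<inter> X = {l}" for X
    using even_sum_deg_if_closed_under[of "C \<inter> X" M] closed_under_Int[OF assms(3) that(1)] that(2) assms(2,4) by simp
  show ?thesis
    unfolding connects_def
  proof (intro allI impI)
    fix X assume X: "closed_under (M + N) X"
    then have "C \<inter> X \<noteq> {l}" "C \<inter> - X \<noteq> {l}"
      using separated closed_under_Compl[of M X] by auto
    then show "insert l B \<subseteq> X \<or> insert l B \<inter> X = {}"
      using assms(1,5,6) X unfolding connects_def by blast
  qed
qed

text \<open>The left label of the piece \<open>q k\<close> decides the parity of the degree of the label \<open>k - 1\<close>.\<close>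

lemma chain_exists:
  assumes "a \<le> b" "y \<in> {b, b + 1}"
  shows "\<exists>Q. spine q {a..b} Q \<and> labels Q \<subseteq> {a..b + 1} \<and> deg (b + 1) Q = of_bool (y = b + 1) \<and>
    (\<forall>l\<in>{a..<b}. even (d l + deg l Q)) \<and> connects Q (insert y {a..b})"
  using assms
proof (induction arbitrary: y rule: dec_induct)
  case base
  have "connects {#Piece a [q a] y#} {a, y}"
    by (auto simp: connects_def)
  then show ?case
    using base by (intro exI[of _ "{#Piece a [q a] y#}"]) (auto intro!: spine_single simp: insert_commute)
next
  case (step b)
  obtain Q where Q: "spine q {a..b} Q" "labels Q \<subseteq> {a..b + 1}"
    "\<And>l. l \<in> {a..<b} \<Longrightarrow> even (d l + deg l Q)" "connects Q (insert (b + 1) {a..b})"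
    using step.IH[of "b + 1"] by auto
  define x where "x = (if even (d b + deg b Q) then b + 1 else b)"
  define p where "p = Piece x [q (b + 1)] y"
  have "spine q ({b + 1} \<union> {a..b}) ({#p#} + Q)"
    unfolding p_def using step.prems by (intro spine_Un spine_single Q(1)) (auto simp: x_def)
  moreover have "{b + 1} \<union> {a..b} = {a..Suc b}"
    using step.hyps by auto
  moreover have "labels ({#p#} + Q) \<subseteq> {a..Suc b + 1}"
    using Q(2) step.hyps step.prems by (auto simp: p_def x_def)
  moreover have "deg (Suc b + 1) Q = 0"
    using Q(2) by (auto simp: deg_eq_0_iff)
  then have "deg (Suc b + 1) ({#p#} + Q) = of_bool (y = Suc b + 1)"
    by (simp add: p_def x_def)
  moreover have "even (d l + deg l ({#p#} + Q))" if "l \<in> {a..<Suc b}" for l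
    using that Q(3)[of l] step.prems by (cases "l = b") (auto simp: p_def x_def)
  moreover have "connects ({#p#} + Q) ({source p, target p} \<union> insert (b + 1) {a..b})"
    using step.hyps
    by (intro connects_insert_piece connects_mono[OF Q(4)]) (simp_all add: p_def x_def)
  then have "connects ({#p#} + Q) (insert y {a..Suc b})"
    by (rule connects_subset) (auto simp: p_def)
  ultimately show ?case by (intro exI[of _ "{#p#} + Q"]) simp
qed

lemma even_chain_exists:
  assumes "a \<le> b" "y \<in> {b, b + 1}" and parity: "even ((\<Sum>l=a..b. d l) + of_bool (y = b + 1))"
  obtains Q where "spine q {a..b} Q" "labels Q \<subseteq> {a..b + 1}" "deg (b + 1) Q = of_bool (y = b + 1)"
    "\<And>l. l \<in> {a..b} \<Longrightarrow> even (d l + deg l Q)" "connects Q (insert y {a..b})"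
proof -
  obtain Q where Q: "spine q {a..b} Q" "labels Q \<subseteq> {a..b + 1}" "deg (b + 1) Q = of_bool (y = b + 1)"
    "\<And>l. l \<in> {a..<b} \<Longrightarrow> even (d l + deg l Q)" "connects Q (insert y {a..b})"
    using chain_exists[OF assms(1,2), of q d] by blast
  have "even (\<Sum>l\<in>{a..b + 1}. deg l Q)"
    using Q(2) by (intro even_sum_deg_if_closed_under closed_under_if_labels_subset) simp_all
  then have "even (\<Sum>l=a..b. d l + deg l Q)"
    using parity assms(1) Q(3) by (simp add: sum.distrib)
  moreover have "(\<Sum>l=a..b. d l + deg l Q) = d b + deg b Q + (\<Sum>l\<in>{a..<b}. d l + deg l Q)"
    using assms(1) by (rule sum.last_plus)
  moreover have "even (\<Sum>l\<in>{a..<b}. d l + deg l Q)"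
    using Q(4) by (intro dvd_sum) blast
  ultimately have "even (d b + deg b Q)"
    by simp
  then have "even (d l + deg l Q)" if "l \<in> {a..b}" for l
    using that Q(4)[of l] by (cases "l = b") auto
  then show ?thesis
    using that Q by blast
qed

lemma ascending_spine:
  assumes "a \<le> m + 1" "a \<le> m \<Longrightarrow> odd (\<Sum>l=a..m. d l)"
  obtains Q where "spine q {a..m} Q" "labels Q \<subseteq> {a..m + 1}"
    "\<And>l. l \<in> {a..m} \<Longrightarrow> even (d l + deg l Q)" "connects Q {a..m + 1}"
proof (cases "a \<le> m")
  case True
  then have "even ((\<Sum>l=a..m. d l) + of_bool (m + 1 = m + 1))"
    using assms(2) by simp
  from even_chain_exists[OF True _ this, of q] obtain Q where Q: "spine q {a..m} Q"
    "labels Q \<subseteq> {a..m + 1}" "\<And>l. l \<in> {a..m} \<Longrightarrow> even (d l + deg l Q)" "connects Q (insert (m + 1) {a..m})"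
    by (metis insertCI)
  moreover have "insert (m + 1) {a..m} = {a..m + 1}"
    using True by auto
  ultimately show ?thesis
    using that by metis
next
  case False
  then have "a = m + 1"
    using assms(1) by simp
  then show ?thesis
    using that[of "{#}"] by (simp add: connects_def)
qed

lemma odd_sum_if_unique_odd:
  fixes f :: "'a \<Rightarrow> nat"
  assumes "finite A" "x \<in> A" "odd (f x)" "\<And>y. y \<in> A - {x} \<Longrightarrow> even (f y)"
  shows "odd (sum f A)"
proof -
  have "even (sum f (A - {x}))"
    using assms(4) by (intro dvd_sum)
  then show ?thesis
    using assms(3) sum.remove[OF assms(1,2), of f] by simp
qed

lemma image_diff_atLeastAtMost_nat:
  fixes a b n :: nat
  assumes "a \<le> n" "b \<le> n"
  shows "(\<lambda>l. n - l) ` {a..b} = {n - b..n - a}"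
proof
  show "{n - b..n - a} \<subseteq> (\<lambda>l. n - l) ` {a..b}"
  proof
    fix l assume "l \<in> {n - b..n - a}"
    then show "l \<in> (\<lambda>l. n - l) ` {a..b}"
      using assms by (intro image_eqI[of _ _ "n - l"]) auto
  qed
qed auto

lemma descending_spine:
  assumes "1 \<le> c \<Longrightarrow> odd (\<Sum>l=1..c. d l)"
  obtains Q where "spine q {1..c} Q" "labels Q \<subseteq> {..c}"
    "\<And>l. l \<in> {1..c} \<Longrightarrow> even (d l + deg l Q)" "connects Q {..c}"
proof -
  let ?f = "\<lambda>l. c + 1 - l"
  have "odd (\<Sum>l=1..c. d (?f l))" if "1 \<le> c"
    using assms[OF that] by (subst (asm) sum.atLeastAtMost_rev) (simp add: add.commute)
  then obtain Q where Q: "spine (\<lambda>k. q (?f k)) {1..c} Q" "labels Q \<subseteq> {1..c + 1}"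
    "\<And>l. l \<in> {1..c} \<Longrightarrow> even (d (?f l) + deg l Q)" "connects Q {1..c + 1}"
    using ascending_spine[of 1 c "\<lambda>l. d (?f l)"] by auto
  have image: "?f ` {1..c} = {1..c}" "?f ` {1..c + 1} = {..c}"
    by (simp_all only: image_diff_atLeastAtMost_nat[of 1 "c + 1"] atLeast0AtMost[symmetric]) simp_all
  have "spine q {1..c} (relabel ?f Q)"
    using spine_reflect[OF Q(1)] image(1) by auto
  moreover have "labels (relabel ?f Q) \<subseteq> {..c}"
    using image_mono[OF Q(2), of ?f] image(2) by simp
  moreover have "connects (relabel ?f Q) {..c}"
    using connects_relabel[OF Q(4), of ?f] image(2) by simp
  moreover have "even (d l + deg l (relabel ?f Q))" if l: "l \<in> {1..c}" for l
  proof -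
    have "inj_on ?f {..c + 1}" "labels Q \<subseteq> {..c + 1}" "?f l \<in> {..c + 1}"
      using Q(2) by (auto simp: inj_on_def)
    from deg_relabel[OF this] have "deg l (relabel ?f Q) = deg (?f l) Q"
      using l by simp
    moreover have "?f l \<in> {1..c}"
      using l by auto
    ultimately show ?thesis
      using Q(3)[of "?f l"] l by simp
  qed
  ultimately show ?thesis
    using that by blast
qed

lemma sum_atMost_eq: "(\<Sum>l\<le>c. f l) = f 0 + (\<Sum>l=1..c. f l)" for f :: "nat \<Rightarrow> nat"
  by (simp add: sum.atLeast_Suc_atMost flip: atLeast0AtMost)

lemma even_sum_deg_with_ends:
  fixes m :: nat
  assumes "labels M \<subseteq> {..m + 1}"
  shows "even (deg 0 M + (\<Sum>l=1..m. deg l M) + deg (m + 1) M)"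
proof -
  have "even (\<Sum>l\<le>m + 1. deg l M)"
    using assms by (intro even_sum_deg_if_closed_under closed_under_if_labels_subset) simp_all
  moreover have "(\<Sum>l\<le>m + 1. deg l M) = deg 0 M + (\<Sum>l=1..m. deg l M) + deg (m + 1) M"
    by (simp add: sum_atMost_eq)
  ultimately show ?thesis
    by (simp only:)
qed

lemma spine_both_sides:
  fixes m :: nat
  assumes "a < b" "b \<le> m + 1"
    and odd_sums: "1 \<le> a \<Longrightarrow> odd (\<Sum>l=1..a. d l)" "b \<le> m \<Longrightarrow> odd (\<Sum>l=b..m. d l)"
  obtains Q where "spine q ({1..a} \<union> {b..m}) Q" "labels Q \<subseteq> {..a} \<union> {b..m + 1}" "a = 0 \<longrightarrow> 0 \<notin> labels Q"
    "\<forall>l\<in>{1..a} \<union> {b..m}. even (d l + deg l Q)" "connects Q {..a}" "connects Q {b..m + 1}"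
proof -
  obtain Q1 where Q1: "spine q {1..a} Q1" "labels Q1 \<subseteq> {..a}"
    "\<And>l. l \<in> {1..a} \<Longrightarrow> even (d l + deg l Q1)" "connects Q1 {..a}"
    using descending_spine[OF odd_sums(1), of q] by blast
  obtain Q2 where Q2: "spine q {b..m} Q2" "labels Q2 \<subseteq> {b..m + 1}"
    "\<And>l. l \<in> {b..m} \<Longrightarrow> even (d l + deg l Q2)" "connects Q2 {b..m + 1}"
    using ascending_spine[of b m d] assms(1,2) odd_sums(2) by auto
  have "deg l Q1 = 0" if "a < l" for l
    using that Q1(2) by (force simp: deg_eq_0_iff)
  moreover have "deg l Q2 = 0" if "l < b" for l
    using that Q2(2) by (force simp: deg_eq_0_iff)
  ultimately have "even (d l + deg l (Q1 + Q2))" if "l \<in> {1..a} \<union> {b..m}" for l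
    using that Q1(3)[of l] Q2(3)[of l] assms(1) by (cases "l \<le> a") auto
  moreover have "spine q ({1..a} \<union> {b..m}) (Q1 + Q2)"
    using assms(1) by (intro spine_Un Q1(1) Q2(1)) auto
  moreover have "connects (Q1 + Q2) {..a}" "connects (Q1 + Q2) {b..m + 1}"
    using Q1(4) Q2(4) by (auto elim: connects_mono)
  moreover have "labels (Q1 + Q2) \<subseteq> {..a} \<union> {b..m + 1}"
    using Q1(2) Q2(2) by auto
  moreover have "0 \<notin> labels (Q1 + Q2)" if "a = 0"
    using that Q1(1) Q2(2) assms(1) by (auto simp: spine_def labels_def)
  ultimately show ?thesis
    using that by blast
qed

lemma Eulerian_spine_cut:
  assumes "labels M \<subseteq> {..m + 1}" "c \<le> m" "\<not> closed_under M {..c}"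
    and odd_sums: "1 \<le> c \<Longrightarrow> odd (\<Sum>l=1..c. deg l M)" "c < m \<Longrightarrow> odd (\<Sum>l=c + 1..m. deg l M)"
  obtains Q where "Eulerian_spine q m M Q" "c = 0 \<Longrightarrow> 0 \<notin> labels Q"
proof -
  obtain Q where Q: "spine q ({1..c} \<union> {c + 1..m}) Q" "labels Q \<subseteq> {..c} \<union> {c + 1..m + 1}"
    "c = 0 \<longrightarrow> 0 \<notin> labels Q" "\<forall>l\<in>{1..c} \<union> {c + 1..m}. even (deg l M + deg l Q)"
    "connects Q {..c}" "connects Q {c + 1..m + 1}"
    using spine_both_sides[of c "c + 1" m "\<lambda>l. deg l M" q] assms(2) odd_sums by auto
  have "{1..c} \<union> {c + 1..m} = {1..m}" "{..c} \<union> {c + 1..m + 1} = {..m + 1}"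
    using assms(2) by auto
  moreover from this have "connects (M + Q) ({..c} \<union> {c + 1..m + 1})"
    using Q(2) assms(1,3)
    by (intro connects_bridge connects_mono[OF Q(5)] connects_mono[OF Q(6)]) simp_all
  ultimately show ?thesis
    using that[of Q] Q(1,3,4) by (simp add: Eulerian_spine_def)
qed

text \<open>The piece of \<open>q j\<close> bridges the gap between the labels \<open>j - 1\<close> and \<open>j + 1\<close>.\<close>

lemma spine_skip:
  assumes even_d: "\<And>l. l \<in> {1..m} \<Longrightarrow> even (d l)" and j: "j \<in> {1..m}"
  obtains Q where "spine q {1..m} Q" "\<And>l. l \<in> {1..m} \<Longrightarrow> even (d l + deg l Q)"
    "connects Q ({..m + 1} - {j})"
proof -
  define p where "p = Piece (j - 1) [q j] (j + 1)"
  define d' where "d' l = d l + deg l {#p#}" for l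
  have odd_left: "odd (\<Sum>l=1..j - 1. d' l)" if "1 \<le> j - 1"
    by (rule odd_sum_if_unique_odd[of _ "j - 1"]) (use that even_d j in \<open>auto simp: d'_def p_def\<close>)
  have ends: "j - 1 < j + 1" "j + 1 \<le> m + 1"
    using j by simp_all
  have odd_right: "odd (\<Sum>l=j + 1..m. d' l)" if "j + 1 \<le> m"
    by (rule odd_sum_if_unique_odd[of _ "j + 1"]) (use that even_d in \<open>auto simp: d'_def p_def\<close>)
  obtain Q where Q: "spine q ({1..j - 1} \<union> {j + 1..m}) Q"
    "labels Q \<subseteq> {..j - 1} \<union> {j + 1..m + 1}" "j - 1 = 0 \<longrightarrow> 0 \<notin> labels Q"
    "\<forall>l\<in>{1..j - 1} \<union> {j + 1..m}. even (d' l + deg l Q)"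
    "connects Q {..j - 1}" "connects Q {j + 1..m + 1}"
    by (rule spine_both_sides[OF ends odd_left odd_right])
  have "spine q ({j} \<union> ({1..j - 1} \<union> {j + 1..m})) ({#p#} + Q)"
    unfolding p_def by (intro spine_Un spine_single Q(1)) auto
  moreover have "{j} \<union> ({1..j - 1} \<union> {j + 1..m}) = {1..m}"
    using j by auto
  moreover have "even (d l + deg l ({#p#} + Q))" if "l \<in> {1..m}" for l
  proof (cases "l = j")
    case True
    then have "deg l Q = 0"
      using Q(2) j by (force simp: deg_eq_0_iff)
    then show ?thesis
      using even_d[OF that] True j by (auto simp: p_def)
  next
    case False
    then have "l \<in> {1..j - 1} \<union> {j + 1..m}"
      using that by auto
    then have "even (d' l + deg l Q)"
      using Q(4) by blast
    then show ?thesis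
      by (simp only: d'_def deg_simps(3) add.assoc)
  qed
  moreover have "connects ({#p#} + Q) ({source p, target p} \<union> {..j - 1} \<union> {j + 1..m + 1})"
    by (intro connects_Un connects_insert_piece connects_mono[OF Q(5)] connects_mono[OF Q(6)])
      (use j in \<open>auto simp: p_def\<close>)
  then have "connects ({#p#} + Q) ({..m + 1} - {j})"
    by (rule connects_subset) auto
  ultimately show ?thesis
    using that by simp
qed

lemma Eulerian_spine_if_even:
  assumes "labels M \<subseteq> {..m + 1}" and even_M: "\<And>l. l \<in> {1..m} \<Longrightarrow> even (deg l M)"
    and p: "p \<in># M" "source p \<in> {1..m}" "target p \<noteq> source p"
  obtains Q where "Eulerian_spine q m M Q"
proof -
  let ?j = "source p"
  obtain Q where Q: "spine q {1..m} Q" "\<And>l. l \<in> {1..m} \<Longrightarrow> even (deg l M + deg l Q)"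
    "connects Q ({..m + 1} - {?j})"
    using spine_skip[of m "\<lambda>l. deg l M" ?j q] even_M p(2) by blast
  have "target p \<in> {..m + 1} - {?j}"
    using p assms(1) by (auto simp: labels_def)
  then have "connects (M + Q) ({?j, target p} \<union> ({..m + 1} - {?j}))"
    using p(1) by (intro connects_insert_piece connects_mono[OF Q(3)]) auto
  then have "connects (M + Q) {..m + 1}"
    by (rule connects_subset) auto
  then show ?thesis
    using that[of Q] Q(1,2) by (simp add: Eulerian_spine_def)
qed

lemma Eulerian_spine_odd_ends:
  assumes "labels M \<subseteq> {..m + 1}" "1 \<le> m" and odd_ends: "odd (deg 0 M)" "odd (deg (m + 1) M)"
    and "c \<le> m" "closed_under M {..c}"
  obtains Q where "Eulerian_spine q m M Q"
proof -
  have "even (\<Sum>l=1..m. deg l M)"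
    using even_sum_deg_with_ends[OF assms(1)] odd_ends by simp
  then obtain Q where Q: "spine q {1..m} Q" "labels Q \<subseteq> {1..m + 1}" "deg (m + 1) Q = 0"
    "\<And>l. l \<in> {1..m} \<Longrightarrow> even (deg l M + deg l Q)" "connects Q {1..m}"
    using even_chain_exists[of 1 m m "\<lambda>l. deg l M" q] assms(2) by (auto simp: insert_absorb)
  have "connects (M + Q) {1..m}"
    using Q(5) by (rule connects_mono) simp
  then have "connects (M + Q) (insert 0 {1..m})"
    by (rule connects_insert_odd[where C = "{..c}"]) (use odd_ends(1) assms(5,6) in auto)
  moreover have "insert 0 {1..m} = {..m}"
    by auto
  ultimately have "connects (M + Q + {#}) {..m}"
    by simp
  moreover have "closed_under (M + Q) {..m + 1}"
    using assms(1) labels_spine[OF Q(1)] by (simp add: closed_under_if_labels_subset)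
  ultimately have "connects (M + Q + {#}) (insert (m + 1) {..m})"
    by (intro connects_insert_odd[where C = "{..m + 1}"]) (use odd_ends(2) Q(3) in auto)
  then have "connects (M + Q) {..m + 1}"
    by (simp add: atMost_Suc)
  then show ?thesis
    using that[of Q] Q(1,4) by (simp add: Eulerian_spine_def)
qed

lemma Eulerian_spine_if_odd_label:
  assumes M: "labels M \<subseteq> {..m + 1}" "1 \<le> m" and parity: "even (deg 0 M) \<longleftrightarrow> even (deg (m + 1) M)"
    and i: "i \<in> {1..m}" "odd (deg i M)"
  obtains Q where "Eulerian_spine q m M Q"
proof -
  define c where "c = (LEAST i. i \<in> {1..m} \<and> odd (deg i M))"
  have c: "c \<in> {1..m}" "odd (deg c M)"
    using LeastI[of "\<lambda>i. i \<in> {1..m} \<and> odd (deg i M)" i] i by (auto simp: c_def)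
  have "even (deg l M)" if "l \<in> {1..c} - {c}" for l
    using that c(1) not_less_Least[of l "\<lambda>i. i \<in> {1..m} \<and> odd (deg i M)"] by (auto simp: c_def)
  then have odd_low: "odd (\<Sum>l=1..c. deg l M)"
    using c by (intro odd_sum_if_unique_odd[of _ c]) auto
  moreover have "even (\<Sum>l=1..m. deg l M)"
    using even_sum_deg_with_ends[OF M(1)] parity by (simp only: even_add) blast
  moreover have "(\<Sum>l=1..m. deg l M) = (\<Sum>l=1..c. deg l M) + (\<Sum>l=c + 1..m. deg l M)"
    using c(1) sum.ub_add_nat[of 1 c "\<lambda>l. deg l M" "m - c"] by simp
  ultimately have odd_high: "odd (\<Sum>l=c + 1..m. deg l M)"
    by simp
  show ?thesis
  proof (cases "closed_under M {..c}")
    case True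
    then have "odd (deg 0 M)"
      using even_sum_deg_if_closed_under[OF _ True] odd_low by (simp add: sum_atMost_eq)
    then show ?thesis
      using Eulerian_spine_odd_ends[OF M _ _ _ True] parity c(1) that by auto
  next
    case False
    then show ?thesis
      using Eulerian_spine_cut[OF M(1) _ False odd_low odd_high] c(1) that by auto
  qed
qed

lemma Eulerian_spine_exists:
  assumes M: "labels M \<subseteq> {..m + 1}" "1 \<le> m"
    and p: "p \<in># M" "source p \<in> {1..m}" "target p \<noteq> source p"
  obtains Q where "Eulerian_spine q m M Q"
proof -
  note parity = even_sum_deg_with_ends[OF M(1)]
  have closed_parity: "even (deg 0 M + (\<Sum>l=1..c. deg l M))" if "closed_under M {..c}" for c
    using even_sum_deg_if_closed_under[OF _ that] by (simp add: sum_atMost_eq)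
  consider (left) "odd (deg 0 M)" "even (deg (m + 1) M)" | (right) "even (deg 0 M)" "odd (deg (m + 1) M)"
    | (even) "\<And>l. l \<in> {1..m} \<Longrightarrow> even (deg l M)"
    | (odd) i where "even (deg 0 M) \<longleftrightarrow> even (deg (m + 1) M)" "i \<in> {1..m}" "odd (deg i M)"
    by blast
  then show ?thesis
  proof cases
    case left
    then show ?thesis
      using Eulerian_spine_cut[OF M(1), of 0] closed_parity[of 0] parity that by auto
  next
    case right
    then show ?thesis
      using Eulerian_spine_cut[OF M(1), of m] closed_parity[of m] parity \<open>1 \<le> m\<close> that by auto
  next
    case even
    then show ?thesis
      using Eulerian_spine_if_even[OF M(1) even p] that by blast
  next
    case odd
    then show ?thesis
      using Eulerian_spine_if_odd_label[OF M] that by blast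
  qed
qed

section \<open>Breaking lists into pieces and gluing them\<close>

definition fits :: "('l \<Rightarrow> 'a set) \<Rightarrow> ('a \<Rightarrow> 'a \<Rightarrow> bool) \<Rightarrow> ('l, 'a) piece \<Rightarrow> bool" where
  "fits N R p \<longleftrightarrow> content p \<noteq> [] \<and> hd (content p) \<in> N (source p) \<and> last (content p) \<in> N (target p) \<and>
     successively R (content p)"

definition enumerates :: "'a list list \<Rightarrow> 'a set \<Rightarrow> bool" where
  "enumerates Ls W \<longleftrightarrow> distinct (concat Ls) \<and> set (concat Ls) = W"

lemma successively_rev_symp: "symp R \<Longrightarrow> successively R (rev xs) \<longleftrightarrow> successively R xs"
  by (auto intro: successively_mono dest: sympD)

lemma sublist_last_hd: "xs \<noteq> [] \<Longrightarrow> ys \<noteq> [] \<Longrightarrow> sublist [last xs, hd ys] (xs @ ys)"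
  by (cases xs rule: rev_cases; cases ys) (auto intro: sublist_appendI[of "[_, _]", simplified])

lemma mset_concat_eq_iff_enumerates:
  assumes "finite W"
  shows "mset (concat Ls) = mset_set W \<longleftrightarrow> enumerates Ls W"
proof
  assume mset: "mset (concat Ls) = mset_set W"
  then have "set (concat Ls) = W"
    using assms by (metis finite_set_mset_mset_set set_mset_mset)
  moreover have "distinct (concat Ls)"
    using mset calculation assms by (metis finite_distinct_list mset_eq_imp_distinct_iff mset_set_set)
  ultimately show "enumerates Ls W"
    by (simp add: enumerates_def)
qed (metis enumerates_def mset_set_set)

lemma enumerates_Union:
  assumes "finite \<K>" "pairwise disjnt \<K>"
    and "\<And>K. K \<in> \<K> \<Longrightarrow> \<exists>Ls. enumerates Ls K \<and> (\<forall>L\<in>set Ls. P L)"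
  shows "\<exists>Ls. enumerates Ls (\<Union>\<K>) \<and> (\<forall>L\<in>set Ls. P L)"
  using assms
proof (induction \<K> rule: finite_induct)
  case empty
  show ?case by (intro exI[of _ "[]"]) (simp add: enumerates_def)
next
  case (insert K \<K>)
  obtain Ls where "enumerates Ls (\<Union>\<K>)" "\<forall>L\<in>set Ls. P L"
    using insert.IH insert.prems by (auto simp: pairwise_insert)
  moreover obtain Ks where "enumerates Ks K" "\<forall>L\<in>set Ks. P L"
    using insert.prems(2)[of K] by auto
  moreover have "K \<inter> \<Union>\<K> = {}"
    using insert.prems(1) insert.hyps(2) by (auto simp: pairwise_insert disjnt_def)
  ultimately show ?case
    by (intro exI[of _ "Ks @ Ls"]) (auto simp: enumerates_def)
qed

lemma choose_pieces:
  assumes "\<And>L. L \<in> set Ls \<Longrightarrow> \<exists>ps. glue ps = L \<and> P L ps"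
  obtains M where "contents M = mset (concat Ls)"
    "\<And>p. p \<in># M \<Longrightarrow> \<exists>L\<in>set Ls. \<exists>ps. P L ps \<and> p \<in> set ps"
    "\<And>L. L \<in> set Ls \<Longrightarrow> \<exists>ps. P L ps \<and> set ps \<subseteq> set_mset M"
proof -
  obtain f where f: "\<And>L. L \<in> set Ls \<Longrightarrow> glue (f L) = L \<and> P L (f L)"
    using assms by metis
  define M where "M = mset (concat (map f Ls))"
  have "contents M = mset (concat Ls)"
    unfolding M_def using f by (induction Ls) (auto simp: contents_mset)
  then show ?thesis
    using that[of M] f by (fastforce simp: M_def)
qed

lemma fits_flip:
  assumes "symp R" "fits N R p"
  shows "fits N R (flip p)"
  using assms by (simp add: fits_def hd_rev last_rev successively_rev_symp del: successively_rev)

lemma fits_reoriented: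
  assumes "reoriented M N" "symp R" "\<And>p. p \<in># M \<Longrightarrow> fits A R p" "q \<in># N"
  shows "fits A R q"
  using reoriented_memberD[OF reoriented_sym[OF assms(1)] assms(4)] assms(2,3) fits_flip[of R A "flip q"]
  by auto

lemma successively_glue_trail:
  assumes "trail a ps b" "ps \<noteq> []" "\<And>p. p \<in> set ps \<Longrightarrow> fits N R p" "distinct (glue ps)"
    and clique: "\<And>l. pairwise R (N l)"
  shows "glue ps \<noteq> [] \<and> hd (glue ps) \<in> N a \<and> last (glue ps) \<in> N b \<and> successively R (glue ps)"
  using assms(2,1,3,4)
proof (induction ps arbitrary: a rule: list_nonempty_induct)
  case (single p)
  then show ?case by (simp add: fits_def)
next
  case (cons p ps)
  have p: "fits N R p" "source p = a"
    using cons.prems by auto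
  have IH: "glue ps \<noteq> []" "hd (glue ps) \<in> N (target p)" "last (glue ps) \<in> N b" "successively R (glue ps)"
    using cons.IH[of "target p"] cons.prems by auto
  have "last (content p) \<in> set (content p)" "hd (glue ps) \<in> set (glue ps)"
    using p(1) hd_in_set[OF IH(1)] by (auto simp: fits_def)
  then have "last (content p) \<noteq> hd (glue ps)"
    using cons.prems(3) by auto
  then have "R (last (content p)) (hd (glue ps))"
    using pairwiseD[OF clique[of "target p"]] p(1) IH(2) by (simp add: fits_def)
  then show ?case
    using p IH by (auto simp: fits_def successively_append_iff hd_append)
qed

lemma lists_along_Euler_trails:
  assumes fits: "\<And>p. p \<in># M \<Longrightarrow> fits N R p" and "symp R" and clique: "\<And>l. pairwise R (N l)"
    and W: "contents M = mset_set W" "finite W"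
    and "\<And>l. l \<notin> {a, b} \<Longrightarrow> even (deg l M)" "connects M (labels M)" "a \<in> labels M" "b \<in> labels M" "a \<noteq> b"
  obtains Ls where "Ls \<noteq> []" "enumerates Ls W"
    "\<And>L. L \<in> set Ls \<Longrightarrow> L \<noteq> [] \<and> hd L \<in> N a \<and> last L \<in> N b \<and> successively R L"
    "\<And>p. p \<in># M \<Longrightarrow> \<exists>L\<in>set Ls. sublist (content p) L \<or> sublist (rev (content p)) L"
    "odd (deg a M) \<Longrightarrow> length Ls = 1"
proof -
  obtain pss where pss: "pss \<noteq> []" "\<And>ps. ps \<in> set pss \<Longrightarrow> trail a ps b" "reoriented M (mset (concat pss))"
    "odd (deg a M) \<Longrightarrow> length pss = 1"
    using Euler_trails_between[OF assms(6-10)] by blast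
  have "glue (concat pss) = concat (map glue pss)"
    by (induction pss) simp_all
  then have enum: "enumerates (map glue pss) W"
    using reoriented_contents[OF pss(3)] W
    by (simp add: contents_mset flip: mset_concat_eq_iff_enumerates)
  have "glue ps \<noteq> [] \<and> hd (glue ps) \<in> N a \<and> last (glue ps) \<in> N b \<and> successively R (glue ps)"
    if ps: "ps \<in> set pss" for ps
  proof (rule successively_glue_trail[OF pss(2)[OF ps] _ _ _ clique])
    show "ps \<noteq> []"
      using pss(2)[OF ps] \<open>a \<noteq> b\<close> by auto
    show "distinct (glue ps)"
      using ps enum by (auto simp: enumerates_def distinct_concat_iff)
    show "fits N R p" if "p \<in> set ps" for p
      using fits_reoriented[OF pss(3) \<open>symp R\<close> fits] that ps by auto
  qed
  moreover have "\<exists>ps\<in>set pss. sublist (content p) (glue ps) \<or> sublist (rev (content p)) (glue ps)"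
    if p: "p \<in># M" for p
    using reoriented_memberD[OF pss(3) p] sublist_glue[of p] sublist_glue[of "flip p"] by auto
  ultimately show ?thesis
    using enum pss(1,4) by (intro that[of "map glue pss"]) auto
qed

lemma sublist_pair_Cons:
  "xs \<noteq> [] \<Longrightarrow> sublist [u, v] (x # xs) \<longleftrightarrow> u = x \<and> v = hd xs \<or> sublist [u, v] xs"
  by (auto simp: sublist_Cons_right neq_Nil_conv)

lemma block_decomposition:
  assumes "L \<noteq> []" "successively (\<lambda>x y. R x y \<or> S x y) L"
  shows "\<exists>Bs. Bs \<noteq> [] \<and> concat Bs = L \<and> (\<forall>B\<in>set Bs. B \<noteq> [] \<and> successively R B) \<and>
    successively (\<lambda>B B'. S (last B) (hd B')) Bs \<and>
    (\<forall>u v. sublist [u, v] L \<longrightarrow> R u v \<longrightarrow> (\<exists>B\<in>set Bs. sublist [u, v] B))"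
  using assms
proof (induction L rule: list_nonempty_induct)
  case (single x)
  show ?case
    by (intro exI[of _ "[[x]]"]) (simp add: sublist_Cons_right)
next
  case (cons x L)
  obtain B Bs where B: "concat (B # Bs) = L" "\<forall>B'\<in>set (B # Bs). B' \<noteq> [] \<and> successively R B'"
    "successively (\<lambda>B B'. S (last B) (hd B')) (B # Bs)"
    "\<And>u v. sublist [u, v] L \<Longrightarrow> R u v \<Longrightarrow> \<exists>B'\<in>set (B # Bs). sublist [u, v] B'"
    using cons.IH cons.prems cons.hyps by (auto simp: neq_Nil_conv successively_Cons)
  have hd_L: "hd L = hd B" "B \<noteq> []"
    using B(1,2) by auto
  note pair_Cons = sublist_pair_Cons[OF cons.hyps(1)]
  show ?case
  proof (cases "R x (hd L)")
    case True
    have "\<exists>B'\<in>set ((x # B) # Bs). sublist [u, v] B'" if "sublist [u, v] (x # L)" "R u v" for u v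
      using that pair_Cons[of u v x] sublist_pair_Cons[OF hd_L(2), of u v x] B(4)[of u v] hd_L(1) by auto
    then show ?thesis
      using B(1-3) hd_L True by (intro exI[of _ "(x # B) # Bs"]) (auto simp: successively_Cons)
  next
    case False
    then have "S x (hd B)"
      using cons.prems cons.hyps hd_L by (auto simp: successively_Cons)
    moreover have "\<exists>B'\<in>set ([x] # B # Bs). sublist [u, v] B'" if "sublist [u, v] (x # L)" "R u v" for u v
      using that pair_Cons[of u v x] B(4)[of u v] False by auto
    ultimately show ?thesis
      using B(1-3) by (intro exI[of _ "[x] # B # Bs"]) auto
  qed
qed

lemma label_blocks:
  assumes "Bs \<noteq> []" "\<And>B. B \<in> set Bs \<Longrightarrow> B \<noteq> [] \<and> successively R B"
    and "successively (\<lambda>B B'. last B \<in> C \<and> hd B' \<in> C) Bs" "hd (hd Bs) \<in> N a" "last (last Bs) \<in> N b"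
    and C: "\<And>x. x \<in> C \<Longrightarrow> \<exists>l\<in>J. x \<in> N l"
  shows "\<exists>ps. map content ps = Bs \<and> source (hd ps) = a \<and> target (last ps) = b \<and>
    (\<forall>p\<in>set ps. fits N R p \<and> source p \<in> insert a J \<and> target p \<in> insert b J)"
  using assms(1-5)
proof (induction Bs arbitrary: a rule: list_nonempty_induct)
  case (single B)
  then show ?case
    by (intro exI[of _ "[Piece a B b]"]) (simp add: fits_def)
next
  case (cons B Bs)
  then have "last B \<in> C" "hd (hd Bs) \<in> C"
    by (auto simp: successively_Cons)
  then obtain j k where jk: "j \<in> J" "last B \<in> N j" "k \<in> J" "hd (hd Bs) \<in> N k"
    using C by meson
  then obtain ps where ps: "map content ps = Bs" "source (hd ps) = k" "target (last ps) = b"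
    "\<forall>p\<in>set ps. fits N R p \<and> source p \<in> insert k J \<and> target p \<in> insert b J"
    using cons.IH[of k] cons.prems cons.hyps by (auto simp: successively_Cons)
  then show ?case
    using cons.prems cons.hyps jk by (intro exI[of _ "Piece a B j # ps"]) (auto simp: fits_def)
qed

lemma list_to_pieces:
  assumes "L \<noteq> []" "successively (\<lambda>x y. R x y \<or> x \<in> C \<and> y \<in> C) L" "hd L \<in> N a" "last L \<in> N b"
    and C: "\<And>x. x \<in> C \<Longrightarrow> \<exists>l\<in>J. x \<in> N l"
  obtains ps where "ps \<noteq> []" "glue ps = L" "source (hd ps) = a" "target (last ps) = b"
    "\<And>p. p \<in> set ps \<Longrightarrow> fits N R p \<and> source p \<in> insert a J \<and> target p \<in> insert b J"
    "\<And>u v. sublist [u, v] L \<Longrightarrow> R u v \<Longrightarrow> \<exists>p\<in>set ps. sublist [u, v] (content p)"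
proof -
  obtain Bs where Bs: "Bs \<noteq> []" "concat Bs = L" "\<And>B. B \<in> set Bs \<Longrightarrow> B \<noteq> [] \<and> successively R B"
    "successively (\<lambda>B B'. last B \<in> C \<and> hd B' \<in> C) Bs"
    "\<And>u v. sublist [u, v] L \<Longrightarrow> R u v \<Longrightarrow> \<exists>B\<in>set Bs. sublist [u, v] B"
    using block_decomposition[OF assms(1,2)] by blast
  have "hd (hd Bs) = hd L"
    using Bs(1-3) hd_concat[of Bs] by simp
  moreover have "last (last Bs) = last L"
    using Bs(1-3) by (cases Bs rule: rev_cases) auto
  ultimately have "\<exists>ps. map content ps = Bs \<and> source (hd ps) = a \<and> target (last ps) = b \<and>
      (\<forall>p\<in>set ps. fits N R p \<and> source p \<in> insert a J \<and> target p \<in> insert b J)"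
    using assms(3,4) by (intro label_blocks[OF Bs(1,3,4) _ _ C]) simp_all
  then obtain ps where ps: "map content ps = Bs" "source (hd ps) = a" "target (last ps) = b"
    "\<forall>p\<in>set ps. fits N R p \<and> source p \<in> insert a J \<and> target p \<in> insert b J"
    by blast
  moreover have "ps \<noteq> []"
    using ps(1) Bs(1) by auto
  ultimately show ?thesis
    using that[of ps] Bs(2,5) by (auto simp: glue_def)
qed

section \<open>Connectivity\<close>

locale undirected =
  fixes E :: "'a rel"
  assumes sym_E: "sym E"
begin

abbreviation reach :: "'a set \<Rightarrow> 'a \<Rightarrow> 'a \<Rightarrow> bool" where
  "reach U x y \<equiv> (x, y) \<in> rtrancl_on U E"

abbreviation walk :: "'a list \<Rightarrow> bool" where
  "walk \<equiv> successively (\<lambda>x y. (x, y) \<in> E)"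

definition connected_set :: "'a set \<Rightarrow> bool" where
  "connected_set U \<longleftrightarrow> (\<forall>x\<in>U. \<forall>y\<in>U. reach U x y)"

definition component :: "'a set \<Rightarrow> 'a \<Rightarrow> 'a set" where
  "component U x = {y. reach U x y}"

text \<open>For a connected \<open>W\<close>, this says that \<open>W\<close> together with a new vertex that is adjacent to all of
  \<open>T\<close> has no cut vertex.\<close>

definition anchored :: "'a set \<Rightarrow> 'a set \<Rightarrow> bool" where
  "anchored W T \<longleftrightarrow> (\<forall>c. \<forall>w\<in>W - {c}. \<exists>v\<in>T. reach (W - {c}) w v)"

lemma E_symD: "(x, y) \<in> E \<Longrightarrow> (y, x) \<in> E"
  using symD[OF sym_E] .

lemma reach_sym: "reach U x y \<Longrightarrow> reach U y x"
  using symD[OF rtrancl_on_sym[OF sym_E]] .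

lemma reach_mono: "reach U x y \<Longrightarrow> U \<subseteq> U' \<Longrightarrow> reach U' x y"
  using rtrancl_on_mono[OF subset_refl] .

lemma reach_first_exit:
  assumes "reach U x v" "x \<in> K"
  shows "\<exists>u. reach K x u \<and> (u = v \<or> u \<in> E `` (U - K))"
  using assms(1)
proof (induction rule: rtrancl_on_induct)
  case base
  then show ?case using assms(2) by blast
next
  case (step y z)
  then obtain u where u: "reach K x u" "u = y \<or> u \<in> E `` (U - K)"
    by blast
  consider (exited) "u \<in> E `` (U - K)" | (inside) "u = y" "z \<in> K" | (exits) "u = y" "z \<in> U - K"
    using u(2) step.hyps by blast
  then show ?case
  proof cases
    case inside
    then show ?thesis using rtrancl_on_into_rtrancl_on[OF u(1), of z] step.hyps(2) by blast
  next
    case exits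
    then show ?thesis using u(1) E_symD[OF step.hyps(2)] by blast
  qed (use u(1) in blast)
qed

lemma connected_set_boundary:
  assumes "connected_set W" "x \<in> K \<inter> W" "y \<in> W - K"
  shows "K \<inter> E `` (W - K) \<noteq> {}"
proof -
  have "reach W x y"
    using assms by (simp add: connected_set_def)
  then obtain u where "reach K x u" "u = y \<or> u \<in> E `` (W - K)"
    using reach_first_exit assms(2) by blast
  then show ?thesis
    using in_rtrancl_on_in_F[of x u K E] assms(3) by blast
qed

lemma connected_set_subset:
  assumes "connected_set W" "K \<subseteq> W" "r \<in> K" "\<And>u. u \<in> K \<inter> E `` (W - K) \<Longrightarrow> reach K u r"
  shows "connected_set K"
proof -
  have "reach K w r" if "w \<in> K" for w
  proof -
    have "reach W w r"
      using assms(1-3) that by (auto simp: connected_set_def)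
    then obtain u where "reach K w u" "u = r \<or> u \<in> E `` (W - K)"
      using reach_first_exit \<open>w \<in> K\<close> by blast
    then show ?thesis
      using assms(4)[of u] in_rtrancl_on_in_F[of w u K E] rtrancl_on_trans[of w u K E r] by blast
  qed
  then show ?thesis
    unfolding connected_set_def using reach_sym[of _ r K] rtrancl_on_trans[of _ r K E] by blast
qed

lemma anchored_subset:
  assumes "anchored W T" "K \<subseteq> W"
    and boundary: "\<And>c u. u \<in> K - {c} \<Longrightarrow> u \<in> T \<union> E `` (W - K) \<Longrightarrow> \<exists>v\<in>T'. reach (K - {c}) u v"
  shows "anchored K T'"
  unfolding anchored_def
proof (intro allI ballI)
  fix c w assume w: "w \<in> K - {c}"
  then obtain v where v: "v \<in> T" "reach (W - {c}) w v"
    using assms(1,2) unfolding anchored_def by blast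
  obtain u where u: "reach (K - {c}) w u" "u = v \<or> u \<in> E `` (W - {c} - (K - {c}))"
    using reach_first_exit[OF v(2) w] by blast
  then have "u \<in> K - {c}" "u \<in> T \<union> E `` (W - K)"
    using in_rtrancl_on_in_F[of w u "K - {c}" E] v(1) by blast+
  then show "\<exists>v\<in>T'. reach (K - {c}) w v"
    using boundary[of u c] rtrancl_on_trans[OF u(1)] by blast
qed

lemma anchored_if_boundary_subset:
  assumes "anchored W T" "K \<subseteq> W" "K \<inter> (T \<union> E `` (W - K)) \<subseteq> T'"
  shows "anchored K T'"
  using assms(1,2) by (rule anchored_subset) (use assms(3) in blast)

lemma component_subset: "component U x \<subseteq> U"
  using in_rtrancl_on_in_F[of x _ U E] by (auto simp: component_def)

lemma component_self: "x \<in> U \<Longrightarrow> x \<in> component U x"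
  by (simp add: component_def)

lemma component_closed: "E `` component U x \<inter> U \<subseteq> component U x"
  unfolding component_def using rtrancl_on_into_rtrancl_on[of x _ U E] by blast

lemma component_boundary: "component U x \<inter> E `` (W - component U x) \<subseteq> E `` (W - U)"
  unfolding component_def using E_symD rtrancl_on_into_rtrancl_on[of x _ U E] by blast

lemma reach_component: "reach U x y \<Longrightarrow> reach (component U x) x y"
proof -
  assume "reach U x y"
  then have "x \<in> component U x"
    using component_self in_rtrancl_on_in_F(1) by metis
  with \<open>reach U x y\<close> obtain u where "reach (component U x) x u"
    "u = y \<or> u \<in> E `` (U - component U x)"
    using reach_first_exit by blast
  then show ?thesis
    using component_boundary[of U x U] in_rtrancl_on_in_F[of x u "component U x" E] by blast
qed

lemma connected_component: "connected_set (component U x)"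
  unfolding connected_set_def
proof (intro ballI)
  fix y z assume "y \<in> component U x" "z \<in> component U x"
  then have "reach (component U x) y x" "reach (component U x) x z"
    using reach_component[of x _ U] reach_sym by (auto simp: component_def)
  then show "reach (component U x) y z"
    by (rule rtrancl_on_trans)
qed

lemma component_eq: "y \<in> component U x \<Longrightarrow> component U y = component U x"
  unfolding component_def
  using reach_sym[of x y U] rtrancl_on_trans[of x y U E] rtrancl_on_trans[of y x U E] by blast

lemma disjoint_components: "pairwise disjnt (component U ` U)"
  unfolding pairwise_def disjnt_def using component_eq by blast

lemma Union_components: "\<Union> (component U ` U) = U"
  using component_subset component_self by fastforce

lemma enumerates_components:
  assumes "finite U" "\<And>x. x \<in> U \<Longrightarrow> \<exists>Ls. enumerates Ls (component U x) \<and> (\<forall>L\<in>set Ls. P L)"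
  shows "\<exists>Ls. enumerates Ls U \<and> (\<forall>L\<in>set Ls. P L)"
proof -
  have "\<exists>Ls. enumerates Ls (\<Union> (component U ` U)) \<and> (\<forall>L\<in>set Ls. P L)"
    using assms disjoint_components by (intro enumerates_Union) auto
  then show ?thesis
    unfolding Union_components .
qed

lemma reach_imp_walk:
  assumes "reach U x y"
  obtains ps where "ps \<noteq> []" "hd ps = x" "last ps = y" "distinct ps" "set ps \<subseteq> U" "walk ps"
proof -
  have "\<exists>ps. ps \<noteq> [] \<and> hd ps = x \<and> last ps = y \<and> distinct ps \<and> set ps \<subseteq> U \<and> walk ps"
    using assms
  proof (induction rule: rtrancl_on_induct)
    case base
    then show ?case by (intro exI[of _ "[x]"]) simp
  next
    case (step y z)
    then obtain ps where ps: "ps \<noteq> []" "hd ps = x" "last ps = y" "distinct ps" "set ps \<subseteq> U" "walk ps"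
      by blast
    show ?case
    proof (cases "z \<in> set ps")
      case True
      then obtain us vs where "ps = us @ z # vs" by (meson split_list)
      then show ?thesis
        using ps by (intro exI[of _ "us @ [z]"]) (auto simp: hd_append successively_append_iff)
    next
      case False
      then show ?thesis
        using ps step.hyps by (intro exI[of _ "ps @ [z]"]) (auto simp: successively_append_iff)
    qed
  qed
  then show ?thesis using that by blast
qed

lemma reach_hd_if_walk: "walk ps \<Longrightarrow> u \<in> set ps \<Longrightarrow> reach (set ps) (hd ps) u"
proof (induction ps)
  case (Cons x ps)
  show ?case
  proof (cases "u = x")
    case False
    then have "ps \<noteq> []" "(x, hd ps) \<in> E" "reach (set ps) (hd ps) u"
      using Cons by (auto simp: successively_Cons)
    then show ?thesis
      using reach_mono[of "hd ps" u "set ps" "set (x # ps)"]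
      by (auto intro: converse_rtrancl_on_into_rtrancl_on)
  qed simp
qed simp

lemma reach_if_walk: "walk ps \<Longrightarrow> u \<in> set ps \<Longrightarrow> v \<in> set ps \<Longrightarrow> reach (set ps) u v"
  using rtrancl_on_trans[OF reach_sym[OF reach_hd_if_walk] reach_hd_if_walk] .

lemma reach_end_avoiding:
  assumes "walk ps" "distinct ps" "u \<in> set ps" "u \<noteq> c"
  shows "reach (set ps - {c}) u (hd ps) \<or> reach (set ps - {c}) u (last ps)"
proof -
  obtain us vs where ps: "ps = us @ u # vs"
    using assms(3) by (meson split_list)
  have walks: "walk (us @ [u])" "walk (u # vs)"
    using assms(1) ps by (auto simp: successively_append_iff)
  consider (before) "c \<notin> set (us @ [u])" | (after) "c \<notin> set (u # vs)"
    using assms(2,4) ps by auto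
  then show ?thesis
  proof cases
    case before
    have "reach (set (us @ [u])) u (hd ps)"
      by (rule reach_if_walk[OF walks(1)]) (auto simp: ps hd_append)
    then have "reach (set ps - {c}) u (hd ps)"
      by (rule reach_mono) (use before in \<open>auto simp: ps\<close>)
    then show ?thesis ..
  next
    case after
    have "reach (set (u # vs)) u (last ps)"
      by (rule reach_if_walk[OF walks(2)]) (auto simp: ps)
    then have "reach (set ps - {c}) u (last ps)"
      by (rule reach_mono) (use after in \<open>auto simp: ps\<close>)
    then show ?thesis ..
  qed
qed

section \<open>Covering along a path\<close>

definition adj2 :: "'a \<Rightarrow> 'a \<Rightarrow> bool" where
  "adj2 x y \<longleftrightarrow> (x, y) \<in> E \<union> E O E"

definition link :: "'a set set \<Rightarrow> 'a \<Rightarrow> 'a \<Rightarrow> bool" where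
  "link \<X> x y \<longleftrightarrow> adj2 x y \<or> (\<exists>X\<in>\<X>. x \<in> X \<and> y \<in> X)"

text \<open>Label \<open>k\<close> stands for the \<open>k\<close>-th vertex of the path \<open>qs\<close>, counted from 1, and the labels \<open>0\<close> and
  \<open>length qs + 1\<close> stand for the sides \<open>X\<close> and \<open>Y\<close>.\<close>

definition slot :: "'a set \<Rightarrow> 'a list \<Rightarrow> 'a set \<Rightarrow> nat \<Rightarrow> 'a set" where
  "slot X qs Y l =
     (if l = 0 then X else if l \<le> length qs then insert (qs ! (l - 1)) (E `` {qs ! (l - 1)}) else Y)"

lemma adj2_sym: "adj2 x y \<Longrightarrow> adj2 y x"
  unfolding adj2_def using E_symD by blast

lemma adj2_if_common_neighbour: "x \<in> E `` {c} \<Longrightarrow> y \<in> E `` {c} \<Longrightarrow> adj2 x y"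
  unfolding adj2_def using E_symD by blast

lemma adj2_if_adjacent: "(x, y) \<in> E \<Longrightarrow> adj2 x y"
  by (simp add: adj2_def)

lemma link_if_adj2: "adj2 x y \<Longrightarrow> link \<X> x y"
  by (simp add: link_def)

lemma symp_link: "symp (link \<X>)"
  using adj2_sym by (auto simp: symp_def link_def)

lemma pairwise_link: "X \<in> \<X> \<Longrightarrow> pairwise (link \<X>) X"
  by (auto simp: pairwise_def link_def)

lemma slot_ends [simp]: "slot X qs Y 0 = X" "slot X qs Y (Suc (length qs)) = Y"
  by (simp_all add: slot_def)

lemma slot_label_exists:
  assumes "x \<in> X \<union> E `` S" "S \<subseteq> set qs"
  obtains l where "l \<le> length qs" "x \<in> slot X qs Y l" "l = 0 \<or> qs ! (l - 1) \<in> S"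
proof (cases "x \<in> X")
  case True
  then show ?thesis using that[of 0] by simp
next
  case False
  then obtain v where v: "v \<in> S" "x \<in> E `` {v}"
    using assms(1) by blast
  then obtain j where "j < length qs" "v = qs ! j"
    using assms(2) by (metis in_set_conv_nth subsetD)
  then show ?thesis
    using that[of "j + 1"] v by (simp add: slot_def)
qed

lemma pairwise_slot:
  assumes "\<And>x y. adj2 x y \<Longrightarrow> R x y" "pairwise R X" "pairwise R Y"
  shows "pairwise R (slot X qs Y l)"
proof -
  have "adj2 x y" if "x \<in> insert v (E `` {v})" "y \<in> insert v (E `` {v})" "x \<noteq> y" for x y v
    using that E_symD by (auto simp: adj2_def)
  then show ?thesis
    using assms by (auto simp: slot_def pairwise_def)
qed

lemma path_vertex_in_slot:
  assumes "walk qs" "k \<in> {1..length qs}" "l \<in> {k - 1..k + 1}" "l = 0 \<Longrightarrow> hd qs \<in> X" "last qs \<in> Y"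
  shows "qs ! (k - 1) \<in> slot X qs Y l"
proof -
  have edge: "(qs ! (i - 1), qs ! i) \<in> E" if "1 \<le> i" "i < length qs" for i
    using successively_nth[OF assms(1), of "i - 1"] that by simp
  consider (first) "l = 0" "k = 1" | (same) "l = k" | (previous) "1 \<le> l" "k = l + 1"
    | (next_vertex) "l = k + 1" "k < length qs" | (last) "l = k + 1" "k = length qs"
    using assms(2,3) by fastforce
  then show ?thesis
  proof cases
    case first
    moreover have "hd qs = qs ! 0"
      using assms(2) by (intro hd_conv_nth) auto
    ultimately show ?thesis using assms(4) by simp
  next
    case same
    then show ?thesis using assms(2) by (simp add: slot_def)
  next
    case previous
    then show ?thesis using assms(2) edge[of l] by (simp add: slot_def)
  next
    case next_vertex
    then show ?thesis using E_symD[OF edge[of k]] assms(2) by (simp add: slot_def)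
  next
    case last
    moreover have "last qs = qs ! (k - 1)"
      using last assms(2) by (subst last_conv_nth) auto
    ultimately show ?thesis using assms(5) by simp
  qed
qed

lemma spine_fits:
  assumes "spine (\<lambda>k. qs ! (k - 1)) {1..length qs} Q" "p \<in># Q"
    and "walk qs" "0 \<in> labels Q \<Longrightarrow> hd qs \<in> X" "last qs \<in> Y"
  shows "fits (slot X qs Y) R p"
proof -
  obtain k where k: "k \<in> {1..length qs}" "content p = [qs ! (k - 1)]" "source p \<in> {k - 1..k + 1}"
    "target p \<in> {k - 1..k + 1}"
    using assms(1,2) by (rule spine_memberE)
  have "source p \<in> labels Q" "target p \<in> labels Q"
    using assms(2) by (auto simp: labels_def)
  then have "qs ! (k - 1) \<in> slot X qs Y (source p)" "qs ! (k - 1) \<in> slot X qs Y (target p)"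
    using path_vertex_in_slot[OF assms(3) k(1) _ _ assms(5)] k(3,4) assms(4) by metis+
  then show ?thesis
    using k(2) by (simp add: fits_def)
qed

lemma contents_path_spine:
  assumes "spine (\<lambda>k. qs ! (k - 1)) {1..length qs} Q"
  shows "contents Q = mset qs"
proof -
  have "mset_set {1..length qs} = mset [1..<length qs + 1]"
    by (metis atLeastLessThanSuc_atLeastAtMost Suc_eq_plus1 mset_upt)
  moreover have "map (\<lambda>k. qs ! (k - 1)) [1..<length qs + 1] = qs"
    by (rule nth_equalityI) (simp_all del: upt_Suc)
  ultimately show ?thesis
    using assms by (simp only: spine_def) (metis mset_map)
qed

lemma cover_along_path:
  assumes "finite W" and qs: "distinct qs" "set qs \<subseteq> W" "walk qs" "last qs \<in> Y"
    and R: "symp R" "\<And>x y. adj2 x y \<Longrightarrow> R x y" "pairwise R X" "pairwise R Y"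
    and M: "contents M = mset_set (W - set qs)" "labels M \<subseteq> {..length qs + 1}"
      "\<And>p. p \<in># M \<Longrightarrow> fits (slot X qs Y) R p"
    and Q: "Eulerian_spine (\<lambda>k. qs ! (k - 1)) (length qs) M Q" "0 \<in> labels Q \<Longrightarrow> hd qs \<in> X"
  obtains Ls where "Ls \<noteq> []" "enumerates Ls W"
    "\<And>L. L \<in> set Ls \<Longrightarrow> L \<noteq> [] \<and> hd L \<in> X \<and> last L \<in> Y \<and> successively R L"
    "\<And>p. p \<in># M \<Longrightarrow> \<exists>L\<in>set Ls. sublist (content p) L \<or> sublist (rev (content p)) L"
    "odd (deg 0 (M + Q)) \<Longrightarrow> length Ls = 1"
proof -
  let ?m = "length qs"
  note labels = labels_Eulerian_spine[OF Q(1) M(2)]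
  have spine: "spine (\<lambda>k. qs ! (k - 1)) {1..?m} Q" and connects: "connects (M + Q) (labels (M + Q))"
    using Q(1) unfolding labels by (simp_all add: Eulerian_spine_def)
  have fits: "fits (slot X qs Y) R p" if "p \<in># M + Q" for p
    using that M(3) spine_fits[OF spine _ qs(3) Q(2) qs(4)] by auto
  have "contents (M + Q) = mset_set (W - set qs) + mset_set (set qs)"
    using M(1) contents_path_spine[OF spine] mset_set_set[OF qs(1)] by simp
  also have "\<dots> = mset_set ((W - set qs) \<union> set qs)"
    using assms(1) by (intro mset_set_Union[symmetric]) auto
  also have "(W - set qs) \<union> set qs = W"
    using qs(2) by blast
  finally have contents: "contents (M + Q) = mset_set W" .
  have ends: "0 \<in> labels (M + Q)" "?m + 1 \<in> labels (M + Q)" "0 \<noteq> ?m + 1"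
    unfolding labels by simp_all
  obtain Ls where "Ls \<noteq> []" "enumerates Ls W"
    "\<And>L. L \<in> set Ls \<Longrightarrow> L \<noteq> [] \<and> hd L \<in> slot X qs Y 0 \<and> last L \<in> slot X qs Y (?m + 1) \<and> successively R L"
    "\<And>p. p \<in># M + Q \<Longrightarrow> \<exists>L\<in>set Ls. sublist (content p) L \<or> sublist (rev (content p)) L"
    "odd (deg 0 (M + Q)) \<Longrightarrow> length Ls = 1"
    using lists_along_Euler_trails[OF fits R(1) pairwise_slot[OF R(2-4)] contents assms(1)
        even_deg_Eulerian_spine[OF Q(1) M(2)] connects ends] by blast
  then show ?thesis
    using that[of Ls] by simp
qed

section \<open>Covering a set by lists between two sides\<close>

definition linkage :: "'a set \<Rightarrow> 'a set \<Rightarrow> 'a list \<Rightarrow> bool" where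
  "linkage X Y L \<longleftrightarrow> L \<noteq> [] \<and> hd L \<in> X \<and> last L \<in> Y \<and> successively (link {X, Y}) L"

lemma component_sides:
  assumes "connected_set W" "anchored W T" "Q \<subseteq> W" "Q \<noteq> {}" "x \<in> W - Q"
  obtains v where "v \<in> Q" "component (W - Q) x \<inter> E `` {v} \<noteq> {}"
    "component (W - Q) x \<inter> (T \<union> E `` (Q - {v})) \<noteq> {}"
proof -
  let ?K = "component (W - Q) x"
  have K: "?K \<subseteq> W - Q"
    by (rule component_subset)
  obtain y where "y \<in> Q"
    using assms(4) by blast
  then have "?K \<inter> E `` (W - ?K) \<noteq> {}"
    using connected_set_boundary[OF assms(1), of x ?K y] component_self[OF assms(5)] assms(3,5) K by blast
  then obtain u where u: "u \<in> ?K" "u \<in> E `` Q"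
    using component_boundary[of "W - Q" x W] by blast
  then obtain v where v: "v \<in> Q" "u \<in> E `` {v}"
    by blast
  have "u \<in> W - {v}"
    using u(1) v(1) K by blast
  then obtain t where t: "t \<in> T" "reach (W - {v}) u t"
    using assms(2) unfolding anchored_def by blast
  obtain y where y: "reach ?K u y" "y = t \<or> y \<in> E `` (W - {v} - ?K)"
    using reach_first_exit[OF t(2) u(1)] by blast
  have "y \<in> ?K"
    using in_rtrancl_on_in_F(2)[OF y(1)] .
  moreover have "y \<in> T \<union> E `` (Q - {v})"
    using y(2) t(1) \<open>y \<in> ?K\<close> component_boundary[of "W - Q" x "W - {v}"] by blast
  ultimately show ?thesis
    using that v u(1) by blast
qed

lemma anchored_component:
  assumes "anchored W T"
  shows "anchored (component (W - Q) x) (T \<union> E `` Q)"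
proof (rule anchored_if_boundary_subset[OF assms])
  show "component (W - Q) x \<subseteq> W"
    using component_subset by fast
  show "component (W - Q) x \<inter> (T \<union> E `` (W - component (W - Q) x)) \<subseteq> T \<union> E `` Q"
    using component_boundary[of "W - Q" x W] by blast
qed

lemma linkage_pieces:
  assumes "v \<in> set qs" "linkage (E `` {v}) (X \<union> Y \<union> E `` (set qs - {v})) L"
  obtains ps where "ps \<noteq> []" "glue ps = L" "source (hd ps) \<in> {1..length qs}"
    "\<And>p. p \<in> set ps \<Longrightarrow> fits (slot X qs Y) (link {X, Y}) p \<and> source p \<le> length qs + 1 \<and>
       target p \<le> length qs + 1 \<and> target p \<noteq> source (hd ps)"
proof -
  define C where "C = X \<union> Y \<union> E `` (set qs - {v})"
  have L: "L \<noteq> []" "hd L \<in> E `` {v}" "last L \<in> C" "successively (link {E `` {v}, C}) L"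
    using assms(2) by (simp_all add: linkage_def C_def)
  obtain j where j: "j < length qs" "v = qs ! j"
    using assms(1) by (metis in_set_conv_nth)
  define J where "J = {..length qs + 1} - {j + 1}"
  have labels: "\<exists>l\<in>J. x \<in> slot X qs Y l" if x: "x \<in> C" for x
  proof (cases "x \<in> Y")
    case True
    then show ?thesis using j(1) by (intro bexI[of _ "Suc (length qs)"]) (auto simp: J_def)
  next
    case False
    then have "x \<in> X \<union> E `` (set qs - {v})"
      using x by (simp add: C_def)
    then obtain l where "l \<le> length qs" "x \<in> slot X qs Y l" "l = 0 \<or> qs ! (l - 1) \<in> set qs - {v}"
      by (rule slot_label_exists) blast
    then show ?thesis using j(2) by (intro bexI[of _ l]) (auto simp: J_def)
  qed
  obtain b where b: "b \<in> J" "last L \<in> slot X qs Y b"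
    using labels[OF L(3)] by blast
  have steps: "successively (\<lambda>x y. link {X, Y} x y \<or> x \<in> C \<and> y \<in> C) L"
    using L(4) adj2_if_common_neighbour by (elim successively_mono) (auto simp: link_def)
  have "hd L \<in> slot X qs Y (j + 1)"
    using L(2) j by (simp add: slot_def)
  then obtain ps where "ps \<noteq> []" "glue ps = L" "source (hd ps) = j + 1"
    "\<And>p. p \<in> set ps \<Longrightarrow> fits (slot X qs Y) (link {X, Y}) p \<and> source p \<in> insert (j + 1) J \<and>
       target p \<in> insert b J"
    using list_to_pieces[OF L(1) steps _ b(2) labels] by blast
  then show ?thesis
    using that[of ps] j(1) b(1) by (force simp: J_def)
qed

lemma pieces_of_linkages:
  assumes "Ls \<noteq> []"
    and "\<And>L. L \<in> set Ls \<Longrightarrow> \<exists>v\<in>set qs. linkage (E `` {v}) (X \<union> Y \<union> E `` (set qs - {v})) L"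
  obtains M where "contents M = mset (concat Ls)" "labels M \<subseteq> {..length qs + 1}"
    "\<And>p. p \<in># M \<Longrightarrow> fits (slot X qs Y) (link {X, Y}) p"
    "\<exists>p\<in>#M. source p \<in> {1..length qs} \<and> target p \<noteq> source p"
proof -
  define P where "P L ps \<longleftrightarrow> ps \<noteq> [] \<and> source (hd ps) \<in> {1..length qs} \<and>
      (\<forall>p\<in>set ps. fits (slot X qs Y) (link {X, Y}) p \<and> source p \<le> length qs + 1 \<and>
         target p \<le> length qs + 1 \<and> target p \<noteq> source (hd ps))" for L :: "'a list" and ps
  have "\<exists>ps. glue ps = L \<and> P L ps" if "L \<in> set Ls" for L
    using assms(2)[OF that] linkage_pieces unfolding P_def by metis
  then obtain M where M: "contents M = mset (concat Ls)"
    "\<And>p. p \<in># M \<Longrightarrow> \<exists>L\<in>set Ls. \<exists>ps. P L ps \<and> p \<in> set ps"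
    "\<And>L. L \<in> set Ls \<Longrightarrow> \<exists>ps. P L ps \<and> set ps \<subseteq> set_mset M"
    using choose_pieces[of Ls P] by blast
  have "fits (slot X qs Y) (link {X, Y}) p" "{source p, target p} \<subseteq> {..length qs + 1}" if "p \<in># M" for p
    using M(2)[OF that] by (auto simp: P_def)
  moreover from this have "labels M \<subseteq> {..length qs + 1}"
    unfolding labels_def by blast
  moreover have "\<exists>p\<in>#M. source p \<in> {1..length qs} \<and> target p \<noteq> source p"
  proof -
    obtain ps where "P (hd Ls) ps" "set ps \<subseteq> set_mset M"
      using M(3)[of "hd Ls"] assms(1) by auto
    then show ?thesis
      by (intro bexI[of _ "hd ps"]) (auto simp: P_def)
  qed
  ultimately show ?thesis
    using that M(1) by blast
qed

lemma linkages_along_path: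
  assumes "finite W" and qs: "qs \<noteq> []" "hd qs \<in> X" "last qs \<in> Y" "distinct qs" "set qs \<subseteq> W" "walk qs"
    and Ks: "enumerates Ks (W - set qs)"
      "\<And>L. L \<in> set Ks \<Longrightarrow> \<exists>v\<in>set qs. linkage (E `` {v}) (X \<union> Y \<union> E `` (set qs - {v})) L"
  shows "\<exists>Ls. enumerates Ls W \<and> (\<forall>L\<in>set Ls. linkage X Y L)"
proof (cases "W = set qs")
  case True
  have "successively (link {X, Y}) qs"
    using qs(6) by (rule successively_mono) (auto intro: link_if_adj2 adj2_if_adjacent)
  then show ?thesis
    using True qs by (intro exI[of _ "[qs]"]) (auto simp: enumerates_def linkage_def)
next
  case False
  then have "Ks \<noteq> []"
    using Ks(1) qs(5) by (auto simp: enumerates_def)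
  then obtain M where M: "contents M = mset (concat Ks)" "labels M \<subseteq> {..length qs + 1}"
    "\<And>p. p \<in># M \<Longrightarrow> fits (slot X qs Y) (link {X, Y}) p"
    "\<exists>p\<in>#M. source p \<in> {1..length qs} \<and> target p \<noteq> source p"
    using pieces_of_linkages[OF _ Ks(2)] by blast
  have contents: "contents M = mset_set (W - set qs)"
    using M(1) Ks(1) assms(1) by (simp add: mset_concat_eq_iff_enumerates)
  have "1 \<le> length qs"
    using qs(1) by (cases qs) auto
  then obtain Q where Q: "Eulerian_spine (\<lambda>k. qs ! (k - 1)) (length qs) M Q"
    using M(4) Eulerian_spine_exists[OF M(2)] by metis
  have cliques: "pairwise (link {X, Y}) X" "pairwise (link {X, Y}) Y"
    by (simp_all add: pairwise_link)
  show ?thesis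
  proof (rule cover_along_path[OF assms(1) qs(4-6,3) symp_link link_if_adj2 cliques contents M(2,3) Q qs(2)])
    fix Ls assume "enumerates Ls W"
      "\<And>L. L \<in> set Ls \<Longrightarrow> L \<noteq> [] \<and> hd L \<in> X \<and> last L \<in> Y \<and> successively (link {X, Y}) L"
    then show ?thesis
      unfolding linkage_def by blast
  qed
qed

theorem two_sided_cover:
  assumes "finite W" "connected_set W" "anchored W (X \<union> Y)" "X \<inter> W \<noteq> {}" "Y \<inter> W \<noteq> {}"
  shows "\<exists>Ls. enumerates Ls W \<and> (\<forall>L\<in>set Ls. linkage X Y L)"
  using assms
proof (induction "card W" arbitrary: W X Y rule: less_induct)
  case less
  obtain a b where ab: "a \<in> X \<inter> W" "b \<in> Y \<inter> W"
    using less.prems(4,5) by blast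
  then have "reach W a b"
    using less.prems(2) by (simp add: connected_set_def)
  then obtain qs where qs: "qs \<noteq> []" "hd qs = a" "last qs = b" "distinct qs" "set qs \<subseteq> W" "walk qs"
    by (rule reach_imp_walk)
  have components: "\<exists>Ks. enumerates Ks (component (W - set qs) x) \<and>
      (\<forall>L\<in>set Ks. \<exists>v\<in>set qs. linkage (E `` {v}) (X \<union> Y \<union> E `` (set qs - {v})) L)"
    if x: "x \<in> W - set qs" for x
  proof -
    let ?K = "component (W - set qs) x"
    have K: "?K \<subseteq> W - set qs"
      by (rule component_subset)
    then have card: "card ?K < card W" "finite ?K"
      using less.prems(1) ab(1) qs(1,2) hd_in_set[OF qs(1)]
      by (auto intro!: psubset_card_mono intro: finite_subset)
    obtain v where v: "v \<in> set qs" "?K \<inter> E `` {v} \<noteq> {}"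
      "?K \<inter> (X \<union> Y \<union> E `` (set qs - {v})) \<noteq> {}"
      using component_sides[OF less.prems(2,3) qs(5) _ x] qs(1) by auto
    have "E `` {v} \<union> (X \<union> Y \<union> E `` (set qs - {v})) = X \<union> Y \<union> E `` set qs"
      using v(1) by blast
    then have "anchored ?K (E `` {v} \<union> (X \<union> Y \<union> E `` (set qs - {v})))"
      using anchored_component[OF less.prems(3)] by simp
    from less.hyps[OF card connected_component this] show ?thesis
      using v by (metis Int_commute)
  qed
  obtain Ks where "enumerates Ks (W - set qs)"
    "\<And>L. L \<in> set Ks \<Longrightarrow> \<exists>v\<in>set qs. linkage (E `` {v}) (X \<union> Y \<union> E `` (set qs - {v})) L"
    using enumerates_components[OF finite_Diff[OF less.prems(1)] components] by blast
  then show ?case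
    using linkages_along_path[OF less.prems(1) qs(1) _ _ qs(4-6)] ab qs(2,3) by simp
qed

section \<open>Hamiltonian lists with a prescribed edge\<close>

definition anchored_to :: "'a set \<Rightarrow> 'a set \<Rightarrow> 'a \<Rightarrow> bool" where
  "anchored_to W X z \<longleftrightarrow> finite W \<and> connected_set W \<and> z \<in> W \<and> anchored W (insert z X)"

definition route :: "'a set \<Rightarrow> 'a set \<Rightarrow> 'a \<Rightarrow> 'a list \<Rightarrow> bool" where
  "route W X z L \<longleftrightarrow> L \<noteq> [] \<and> distinct L \<and> set L = W \<and> hd L \<in> X \<and> last L = z \<and>
     successively (link {X}) L"

definition edge_at :: "'a \<Rightarrow> 'a list \<Rightarrow> bool" where
  "edge_at t L \<longleftrightarrow> (\<exists>b. (t, b) \<in> E \<and> (sublist [t, b] L \<or> sublist [b, t] L))"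

definition routes_below :: "nat \<Rightarrow> bool" where
  "routes_below n \<longleftrightarrow> (\<forall>W X z t. card W < n \<longrightarrow> anchored_to W X z \<longrightarrow> t \<in> W - {z} \<longrightarrow>
     (\<exists>L. route W X z L \<and> edge_at t L))"

lemma edge_at_mono:
  assumes "edge_at t L" "sublist L L' \<or> sublist (rev L) L'"
  shows "edge_at t L'"
proof -
  obtain b where b: "(t, b) \<in> E" "sublist [t, b] L \<or> sublist [b, t] L"
    using assms(1) by (auto simp: edge_at_def)
  then have "sublist [b, t] (rev L) \<or> sublist [t, b] (rev L)"
    using sublist_rev[of "[t, b]" L] sublist_rev[of "[b, t]" L] by auto
  then show ?thesis
    using b assms(2) sublist_order.order_trans unfolding edge_at_def by blast
qed

lemma anchored_to_reaches:
  assumes "anchored_to W X z" "w \<in> W - {z}"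
  obtains v where "v \<in> X" "reach (W - {z}) w v"
  using assms in_rtrancl_on_in_F(2)[of w _ "W - {z}" E] unfolding anchored_to_def anchored_def by blast

lemma route_exists:
  assumes "routes_below n" "card W < n" "anchored_to W X z" "X \<inter> W \<noteq> {}"
  shows "\<exists>L. route W X z L \<and> (t \<in> W - {z} \<longrightarrow> edge_at t L)"
proof (cases "W = {z}")
  case True
  then show ?thesis
    using assms(4) by (intro exI[of _ "[z]"]) (auto simp: route_def)
next
  case False
  moreover have "z \<in> W"
    using assms(3) by (simp add: anchored_to_def)
  ultimately obtain t' where "t' \<in> W - {z}" "t \<in> W - {z} \<longrightarrow> t' = t"
    by (cases "t \<in> W - {z}") auto
  then show ?thesis
    using assms(1-3) unfolding routes_below_def by metis
qed

lemma route_append: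
  assumes "route W X u L" "route W' (E `` {v}) z L'" "W \<inter> W' = {}" "adj2 u (hd L')"
  shows "route (W \<union> W') X z (L @ L')"
proof -
  have "successively (link {X}) L'"
    using assms(2) adj2_if_common_neighbour unfolding route_def
    by (auto elim!: successively_mono simp: link_def)
  then show ?thesis
    using assms link_if_adj2 by (auto simp: route_def successively_append_iff)
qed

lemma route_snoc:
  "route W X u L \<Longrightarrow> (u, t) \<in> E \<Longrightarrow> t \<notin> W \<Longrightarrow> route (insert t W) X t (L @ [t])"
  using link_if_adj2 adj2_if_adjacent by (auto simp: route_def successively_append_iff)

lemma edge_at_append: "L \<noteq> [] \<Longrightarrow> L' \<noteq> [] \<Longrightarrow> (last L, hd L') \<in> E \<Longrightarrow> edge_at (last L) (L @ L')"
  using sublist_last_hd unfolding edge_at_def by blast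

lemma anchored_to_component_and_rest:
  assumes W: "anchored_to W X z" and t: "t \<in> W - {z}"
    and sep: "component (W - {t}) z \<inter> X \<subseteq> {z}"
  shows "anchored_to (component (W - {t}) z) (E `` {t}) z"
    and "anchored_to (W - component (W - {t}) z) X t"
proof -
  let ?Z = "component (W - {t}) z"
  have finite: "finite W" and connected: "connected_set W" and zW: "z \<in> W"
    and anchored: "anchored W (insert z X)"
    using W by (simp_all add: anchored_to_def)
  have Z: "?Z \<subseteq> W - {t}" "z \<in> ?Z"
    using component_subset component_self[of z "W - {t}"] zW t by blast+
  have "?Z \<inter> E `` (W - ?Z) \<subseteq> E `` {t}"
    using component_boundary[of "W - {t}" z W] by blast
  then have "anchored ?Z (insert z (E `` {t}))"
    using Z sep by (intro anchored_if_boundary_subset[OF anchored]) blast+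
  then show "anchored_to ?Z (E `` {t}) z"
    using finite Z connected_component finite_subset[of ?Z W] by (auto simp: anchored_to_def)
  have "W - (W - ?Z) = ?Z"
    using Z(1) by blast
  moreover have "(W - ?Z) \<inter> E `` ?Z \<subseteq> {t}"
    using component_closed[of "W - {t}" z] by blast
  ultimately have "connected_set (W - ?Z)" "anchored (W - ?Z) (insert t X)"
    using Z t
    by (auto intro!: connected_set_subset[OF connected, of _ t] anchored_if_boundary_subset[OF anchored])
  then show "anchored_to (W - ?Z) X t"
    using finite Z(1) t by (auto simp: anchored_to_def)
qed

lemma route_if_separated:
  assumes below: "routes_below (card W)" and W: "anchored_to W X z" and t: "t \<in> W - {z}"
    and sep: "component (W - {t}) z \<inter> X \<subseteq> {z}"
  shows "\<exists>L. route W X z L \<and> edge_at t L"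
proof -
  define Z where "Z = component (W - {t}) z"
  note anchored_Z = anchored_to_component_and_rest(1)[OF W t sep, folded Z_def]
    and anchored_rest = anchored_to_component_and_rest(2)[OF W t sep, folded Z_def]
  have Z: "Z \<subseteq> W - {t}" "z \<in> Z" and W': "finite W" "connected_set W"
    using component_subset[of "W - {t}" z] anchored_Z W by (auto simp: anchored_to_def Z_def)
  have card: "card (W - Z) < card W" "card Z < card W"
    using W'(1) Z t by (auto intro!: psubset_card_mono)
  have "X \<inter> (W - Z) \<noteq> {}"
    using anchored_to_reaches[OF W t] in_rtrancl_on_in_F(2)[of t _ "W - {z}" E] sep
    unfolding Z_def by blast
  then obtain L where L: "route (W - Z) X t L"
    using route_exists[OF below card(1) anchored_rest] by blast
  have "Z \<inter> E `` (W - Z) \<noteq> {}"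
    using connected_set_boundary[OF W'(2), of z Z t] Z t by blast
  then have "E `` {t} \<inter> Z \<noteq> {}"
    using component_boundary[of "W - {t}" z W] unfolding Z_def by blast
  then obtain L' where L': "route Z (E `` {t}) z L'"
    using route_exists[OF below card(2) anchored_Z] by blast
  have edge: "(t, hd L') \<in> E"
    using L' by (simp add: route_def)
  have "route (W - Z \<union> Z) X z (L @ L')"
    using edge by (intro route_append[OF L L'] adj2_if_adjacent) auto
  moreover have "W - Z \<union> Z = W"
    using Z(1) by blast
  moreover have "edge_at t (L @ L')"
    using edge_at_append[of L L'] edge L L' by (auto simp: route_def)
  ultimately show ?thesis by auto
qed

lemma join_linkages:
  assumes "\<And>L. L \<in> set Ls \<Longrightarrow> linkage X Y L"
  shows "\<exists>L. mset L = mset (concat Ls) \<and> successively (link {X, Y}) L \<and>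
    (L \<noteq> [] \<longrightarrow> hd L \<in> X \<and> last L \<in> X \<union> Y)"
  using assms
proof (induction Ls rule: rev_induct)
  case Nil
  show ?case by simp
next
  case (snoc K Ls)
  obtain L where L: "mset L = mset (concat Ls)" "successively (link {X, Y}) L"
    "L \<noteq> [] \<longrightarrow> hd L \<in> X \<and> last L \<in> X \<union> Y"
    using snoc.IH snoc.prems by auto
  have K: "K \<noteq> []" "hd K \<in> X" "last K \<in> Y" "successively (link {X, Y}) K"
    using snoc.prems[of K] by (simp_all add: linkage_def)
  show ?case
  proof (cases "L = [] \<or> last L \<in> X")
    case True
    then show ?thesis
      using L K by (intro exI[of _ "L @ K"]) (auto simp: successively_append_iff link_def hd_append)
  next
    case False
    moreover have "successively (link {X, Y}) (rev K)"
      using K(4) successively_rev_symp[OF symp_link] by blast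
    ultimately show ?thesis
      using L K by (intro exI[of _ "L @ rev K"])
        (auto simp: successively_append_iff link_def hd_append hd_rev last_rev simp del: successively_rev)
  qed
qed

lemma pendant_component_cover:
  assumes W: "anchored_to W X z" and pendant: "E `` {t} \<inter> W \<subseteq> {z, t}" and x: "x \<in> W - {t, z}"
  shows "\<exists>Ls. enumerates Ls (component (W - {t, z}) x) \<and> (\<forall>L\<in>set Ls. linkage X (E `` {z}) L)"
proof (rule two_sided_cover)
  let ?K = "component (W - {t, z}) x"
  have K: "?K \<subseteq> W - {t, z}" "x \<in> ?K"
    using component_subset component_self[OF x] by auto
  have boundary: "?K \<inter> E `` (W' - ?K) \<subseteq> E `` (W' \<inter> {z})" if "W' \<subseteq> W" for W'
    using component_boundary[of "W - {t, z}" x W'] that pendant K(1) E_symD by blast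
  show "finite ?K"
    using W K(1) by (auto simp: anchored_to_def intro: finite_subset)
  show "anchored ?K (X \<union> E `` {z})"
  proof (rule anchored_if_boundary_subset)
    show "anchored W (insert z X)"
      using W by (simp add: anchored_to_def)
  qed (use K(1) boundary[of W] in blast)+
  show "E `` {z} \<inter> ?K \<noteq> {}"
    using W K boundary[of W] connected_set_boundary[of W x ?K z] by (auto simp: anchored_to_def)
  obtain v where v: "v \<in> X" "reach (W - {z}) x v"
    using anchored_to_reaches[OF W, of x] x by blast
  from reach_first_exit[OF v(2) K(2)] show "X \<inter> ?K \<noteq> {}"
    using v(1) boundary[of "W - {z}"] in_rtrancl_on_in_F(2)[of x _ ?K E] by blast
qed (rule connected_component)

lemma route_if_pendant:
  assumes W: "anchored_to W X z" and t: "t \<in> W - {z}" and pendant: "E `` {t} \<inter> W \<subseteq> {z, t}"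
  shows "\<exists>L. route W X z L \<and> edge_at t L"
proof -
  have finite: "finite W" and connected: "connected_set W" and zW: "z \<in> W"
    using W by (simp_all add: anchored_to_def)
  have "{t} \<inter> E `` (W - {t}) \<noteq> {}"
    using connected t zW by (intro connected_set_boundary[of W t _ z]) auto
  then have tz: "(t, z) \<in> E"
    using pendant E_symD by blast
  have tX: "t \<in> X"
  proof -
    obtain v where v: "v \<in> X" "reach (W - {z}) t v"
      using anchored_to_reaches[OF W t] .
    then obtain u where "reach {t} t u" "u = v \<or> u \<in> E `` (W - {z} - {t})"
      using reach_first_exit[of t v _ "{t}"] by blast
    moreover from this have "u = t"
      using in_rtrancl_on_in_F(2)[of t u "{t}" E] by blast
    ultimately show ?thesis
      using v(1) pendant E_symD by blast
  qed
  obtain Ls where Ls: "enumerates Ls (W - {t, z})" "\<And>L. L \<in> set Ls \<Longrightarrow> linkage X (E `` {z}) L"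
    using enumerates_components[OF finite_Diff[OF finite] pendant_component_cover[OF W pendant]] by blast
  obtain L where L: "mset L = mset (concat Ls)" "successively (link {X, E `` {z}}) L"
    "L \<noteq> [] \<longrightarrow> hd L \<in> X \<and> last L \<in> X \<union> E `` {z}"
    using join_linkages[OF Ls(2)] by blast
  have "distinct L" "set L = W - {t, z}"
    using L(1) Ls(1) mset_eq_imp_distinct_iff mset_eq_setD unfolding enumerates_def by metis+
  moreover have "successively (link {X}) L"
    using L(2) adj2_if_common_neighbour by (elim successively_mono) (auto simp: link_def)
  moreover have "link {X} (last L) t" if "L \<noteq> []"
    using L(3) that tX E_symD[OF tz] adj2_if_common_neighbour[of "last L" z t] by (auto simp: link_def)
  ultimately have "route W X z (L @ [t, z])"
    using L(3) tX tz zW t link_if_adj2[OF adj2_if_adjacent[OF tz]]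
    by (cases "L = []") (auto simp: route_def successively_append_iff)
  moreover have "edge_at t (L @ [t, z])"
    using tz sublist_append_leftI[of "[t, z]" L] unfolding edge_at_def by blast
  ultimately show ?thesis by blast
qed

lemma anchored_if_boundary_on_walk:
  assumes "anchored W T" "K \<subseteq> W" "walk ps" "distinct ps" "set ps \<subseteq> K" "hd ps \<in> T'" "last ps \<in> T'"
    and "K \<inter> (T \<union> E `` (W - K)) \<subseteq> T' \<union> set ps"
  shows "anchored K T'"
  using assms(1,2)
proof (rule anchored_subset)
  fix c u assume u: "u \<in> K - {c}" "u \<in> T \<union> E `` (W - K)"
  show "\<exists>v\<in>T'. reach (K - {c}) u v"
  proof (cases "u \<in> T'")
    case True
    then show ?thesis using u(1) by blast
  next
    case False
    then have "u \<in> set ps" "u \<noteq> c"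
      using u assms(8) by blast+
    from reach_end_avoiding[OF assms(3,4) this] show ?thesis
      using assms(5-7) reach_mono[of u _ "set ps - {c}" "K - {c}"] by blast
  qed
qed

context
  fixes W X :: "'a set" and z t y :: 'a and r1 r2 :: "'a list"
  assumes W: "anchored_to W X z" and t: "t \<in> W - {z}" and ty: "(t, y) \<in> E"
    and walk: "walk (r1 @ y # r2)" "distinct (r1 @ y # r2)" "set (r1 @ y # r2) \<subseteq> W - {t}"
    and ends: "r1 \<noteq> []" "hd r1 = z" "last (y # r2) \<in> X"
    and neighbours: "E `` {t} \<inter> W \<subseteq> {z, t} \<union> set (r1 @ y # r2)"
    and cut: "component (W - {t, y}) z \<inter> X \<subseteq> {z}"
begin

lemma walks_split:
  "walk r1" "(last r1, y) \<in> E" "walk (y # r2)"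
  using walk(1) ends(1) by (auto simp: successively_append_iff)

lemma near_part_subset: "set r1 \<subseteq> component (W - {t, y}) z"
proof
  fix x assume x: "x \<in> set r1"
  have "reach (set r1) z x"
    using reach_hd_if_walk[OF walks_split(1) x] ends(2) by simp
  moreover have "set r1 \<subseteq> W - {t, y}"
    using walk(2,3) by auto
  ultimately show "x \<in> component (W - {t, y}) z"
    unfolding component_def using reach_mono by blast
qed

lemma far_part_disjoint: "set (y # r2) \<inter> component (W - {t, y}) z = {}"
proof (rule ccontr)
  assume "\<not> ?thesis"
  then obtain x where x: "x \<in> set (y # r2)" "x \<in> component (W - {t, y}) z"
    by blast
  then have x_r2: "x \<in> set r2"
    using component_subset[of "W - {t, y}" z] by auto
  then have r2: "r2 \<noteq> []" "walk r2" "last (y # r2) = last r2"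
    using walks_split(3) by (auto simp: successively_Cons)
  have "reach (set r2) x (last r2)"
    using x_r2 r2 by (intro reach_if_walk) auto
  then have "reach (W - {t, y}) x (last r2)"
    by (rule reach_mono) (use walk(2,3) in auto)
  then have "last r2 \<in> component (W - {t, y}) z"
    using x(2) rtrancl_on_trans[of z x "W - {t, y}" E "last r2"] by (simp add: component_def)
  then have "last r2 = z"
    using cut ends(3) r2(3) by auto
  then show False
    using walk(2) ends(1,2) r2(1) hd_in_set[of r1] last_in_set[of r2] by auto
qed

lemma anchored_to_near_part: "anchored_to (component (W - {t, y}) z) (E `` {y}) z"
proof -
  let ?Z = "component (W - {t, y}) z"
  have Z: "?Z \<subseteq> W - {t, y}" "z \<in> ?Z"
    using component_subset near_part_subset hd_in_set[OF ends(1)] ends(2) by auto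
  have "?Z \<inter> (insert z X \<union> E `` (W - ?Z)) \<subseteq> insert z (E `` {y}) \<union> set r1"
  proof
    fix u assume u: "u \<in> ?Z \<inter> (insert z X \<union> E `` (W - ?Z))"
    then consider (end_vertex) "u = z" | (neighbour_y) "u \<in> E `` {y}" | (neighbour_t) "u \<in> E `` {t}"
      using cut component_boundary[of "W - {t, y}" z W] by blast
    then show "u \<in> insert z (E `` {y}) \<union> set r1"
    proof cases
      case neighbour_t
      then have "u \<in> {z, t} \<union> set (r1 @ y # r2)"
        using u Z(1) neighbours by blast
      then show ?thesis
        using u Z(1) far_part_disjoint by auto
    qed auto
  qed
  then have "anchored ?Z (insert z (E `` {y}))"
    using W Z(1) walk(2) walks_split ends(2) near_part_subset E_symD
    by (intro anchored_if_boundary_on_walk[of W "insert z X" ?Z r1]) (auto simp: anchored_to_def)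
  then show ?thesis
    using W Z connected_component finite_subset[of ?Z W] by (auto simp: anchored_to_def)
qed

lemma anchored_to_far_part: "anchored_to (W - component (W - {t, y}) z - {t}) X y"
proof -
  let ?K = "W - component (W - {t, y}) z - {t}"
  have far: "set (y # r2) \<subseteq> ?K"
    using far_part_disjoint walk(3) by auto
  have "z \<in> component (W - {t, y}) z"
    using near_part_subset ends(1,2) hd_in_set[of r1] by auto
  then have boundary: "?K \<inter> E `` (W - ?K) \<subseteq> set (y # r2)"
    using component_closed[of "W - {t, y}" z] neighbours near_part_subset by auto
  have to_y: "reach ?K u y" if "u \<in> ?K \<inter> E `` (W - ?K)" for u
    using reach_if_walk[OF walks_split(3) subsetD[OF boundary that], of y]
    by (intro reach_mono[OF _ far]) simp
  have "connected_set W" "anchored W (insert z X)" "?K \<subseteq> W" "y \<in> ?K"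
    using W far by (auto simp: anchored_to_def)
  moreover from this have "connected_set ?K"
    using connected_set_subset[OF _ _ _ to_y] by blast
  moreover have "?K \<inter> (insert z X \<union> E `` (W - ?K)) \<subseteq> insert y X \<union> set (y # r2)"
    using boundary \<open>z \<in> component (W - {t, y}) z\<close> by blast
  then have "anchored ?K (insert y X)"
    using anchored_if_boundary_on_walk[OF calculation(2,3) walks_split(3) _ far] walk(2) ends(3) by simp
  ultimately show ?thesis
    using W by (simp add: anchored_to_def)
qed

lemma route_if_cut_by_edge:
  assumes below: "routes_below (card W)"
  shows "\<exists>L. route W X z L \<and> edge_at t L"
proof -
  define Z K where "Z = component (W - {t, y}) z" and "K = W - Z - {t}"
  have sets: "Z \<subseteq> W - {t}" "z \<in> Z" "W = insert t (K \<union> Z)" "t \<notin> K" "K \<inter> Z = {}" "finite W" "t \<in> W"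
    using component_subset[of "W - {t, y}" z] near_part_subset ends(1,2) hd_in_set[of r1] W t
    by (auto simp: Z_def K_def anchored_to_def)
  have card: "card K < card W" "card Z < card W"
    using sets by (auto intro!: psubset_card_mono)
  have "last (y # r2) \<in> K"
    using far_part_disjoint walk(3) last_in_set[of "y # r2"] by (auto simp: K_def Z_def)
  then obtain L where L: "route K X y L"
    using route_exists[OF below card(1)] anchored_to_far_part ends(3) unfolding K_def Z_def by blast
  have "last r1 \<in> E `` {y} \<inter> Z"
    using near_part_subset last_in_set[OF ends(1)] E_symD[OF walks_split(2)] by (auto simp: Z_def)
  then obtain L' where L': "route Z (E `` {y}) z L'"
    using route_exists[OF below card(2)] anchored_to_near_part unfolding Z_def by blast
  have "adj2 t (hd L')"
    using L' ty by (auto simp: route_def adj2_def)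
  then have "route (insert t K \<union> Z) X z ((L @ [t]) @ L')"
    using sets E_symD[OF ty] by (intro route_append[OF route_snoc[OF L] L']) auto
  moreover have "edge_at t (L @ [t])"
    using L ty sublist_last_hd[of L "[t]"] unfolding edge_at_def route_def by auto
  then have "edge_at t ((L @ [t]) @ L')"
    by (rule edge_at_mono) blast
  ultimately show ?thesis
    using sets(3) by (metis Un_insert_left)
qed

end

lemma edge_at_content:
  assumes "edge_at t L"
    and "\<And>u v. sublist [u, v] L \<Longrightarrow> link \<X> u v \<Longrightarrow> \<exists>p\<in>set ps. sublist [u, v] (content p)"
  shows "\<exists>p\<in>set ps. edge_at t (content p)"
proof -
  obtain b where b: "(t, b) \<in> E" "sublist [t, b] L \<or> sublist [b, t] L"
    using assms(1) by (auto simp: edge_at_def)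
  have "link \<X> t b" "link \<X> b t"
    using b(1) E_symD link_if_adj2 adj2_if_adjacent by blast+
  then show ?thesis
    using b assms(2) unfolding edge_at_def by blast
qed

context
  fixes W X :: "'a set" and z t y v0 :: 'a and qs :: "'a list"
  assumes W: "anchored_to W X z" and t: "t \<in> W" and y: "y \<in> W" "(t, y) \<in> E" "t \<noteq> y"
    and v0: "v0 \<in> X" "(v0, hd qs) \<in> E"
    and qs: "qs \<noteq> []" "last qs = z" "distinct (v0 # qs)" "walk qs" "set (v0 # qs) \<subseteq> W - {t, y}"
begin

lemma end_of_component_list:
  assumes "x \<in> W - set qs"
  obtains z' where "z' \<in> component (W - set qs) x" "z' \<in> X \<union> E `` set qs"
    "v0 \<in> component (W - set qs) x \<longrightarrow> z' = v0" "z' \<noteq> t"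
proof (cases "v0 \<in> component (W - set qs) x")
  case True
  then show ?thesis using that[of v0] v0(1) qs(5) by auto
next
  case False
  let ?V = "component (W - set qs) x"
  define w where "w = (if t \<in> ?V then y else x)"
  have "y \<in> ?V" if "t \<in> ?V"
    using component_closed[of "W - set qs" x] that y(1,2) qs(5) by auto
  then have "w \<in> ?V - {t}"
    using component_self[OF assms] y(3) by (auto simp: w_def)
  moreover have "anchored ?V (insert z X \<union> E `` set qs)"
    using W by (intro anchored_component) (simp add: anchored_to_def)
  ultimately obtain v where v: "v \<in> insert z X \<union> E `` set qs" "reach (?V - {t}) w v"
    unfolding anchored_def by blast
  have "v \<in> ?V - {t}"
    using in_rtrancl_on_in_F(2)[OF v(2)] .
  moreover have "z \<in> set qs"
    using qs(1,2) last_in_set by blast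
  then have "z \<notin> ?V"
    using component_subset[of "W - set qs" x] by blast
  ultimately show ?thesis
    using that[of v] v(1) False by blast
qed

lemma component_list:
  assumes below: "routes_below (card W)" and x: "x \<in> W - set qs"
  obtains L where "enumerates [L] (component (W - set qs) x)" "linkage (X \<union> E `` set qs) (X \<union> E `` set qs) L"
    "t \<in> set L \<Longrightarrow> edge_at t L" "v0 \<in> set L \<Longrightarrow> last L = v0"
proof -
  let ?V = "component (W - set qs) x"
  obtain z' where z': "z' \<in> ?V" "z' \<in> X \<union> E `` set qs" "v0 \<in> ?V \<longrightarrow> z' = v0" "z' \<noteq> t"
    using x by (rule end_of_component_list)
  have z: "z \<in> set qs" "z \<in> W" and finite: "finite W"
    using qs(1,2) W by (auto simp: anchored_to_def)
  have V: "?V \<subseteq> W - set qs"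
    by (rule component_subset)
  have "anchored ?V (insert z X \<union> E `` set qs)"
    using W by (intro anchored_component) (simp add: anchored_to_def)
  then have "anchored ?V (insert z' (X \<union> E `` set qs))"
    by (rule anchored_if_boundary_subset) (use V z(1) in blast)+
  then have "anchored_to ?V (X \<union> E `` set qs) z'"
    using z'(1) connected_component finite_subset[OF V] finite by (simp add: anchored_to_def)
  moreover have "card ?V < card W"
    using V z finite by (intro psubset_card_mono) auto
  ultimately obtain L where L: "route ?V (X \<union> E `` set qs) z' L" "t \<in> ?V - {z'} \<longrightarrow> edge_at t L"
    using route_exists[OF below] z'(1,2) by blast
  then have "enumerates [L] ?V" "linkage (X \<union> E `` set qs) (X \<union> E `` set qs) L" "last L = z'" "set L = ?V"
    using z'(2) by (simp_all add: route_def enumerates_def linkage_def)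
  then show ?thesis
    using that L(2) z'(3,4) by blast
qed

lemma slot_label_with_v0:
  assumes "x \<in> X \<union> E `` set qs"
  shows "\<exists>l\<in>{..length qs}. x \<in> slot X qs {z} l \<and> (x = v0 \<longrightarrow> l = 1)"
proof (cases "x = v0")
  case True
  have "hd qs = qs ! 0" "1 \<le> length qs"
    using qs(1) by (simp_all add: hd_conv_nth Suc_leI)
  then show ?thesis
    using True v0(2) E_symD by (auto simp: slot_def)
next
  case False
  then show ?thesis
    using slot_label_exists[OF assms order.refl] by (metis atMost_iff)
qed

lemma pieces_of_component_list:
  assumes L: "linkage (X \<union> E `` set qs) (X \<union> E `` set qs) L" "t \<in> set L \<longrightarrow> edge_at t L"
    "v0 \<in> set L \<longrightarrow> last L = v0"
  shows "\<exists>ps. glue ps = L \<and>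
    (\<forall>p\<in>set ps. fits (slot X qs {z}) (link {X}) p \<and> source p \<le> length qs \<and> target p \<le> length qs) \<and>
    (t \<in> set L \<longrightarrow> (\<exists>p\<in>set ps. edge_at t (content p))) \<and>
    (v0 \<in> set L \<longrightarrow> (\<exists>p\<in>set ps. target p = 1 \<and> last (content p) = v0))"
proof -
  have L': "L \<noteq> []" "hd L \<in> X \<union> E `` set qs" "last L \<in> X \<union> E `` set qs"
    "successively (link {X \<union> E `` set qs}) L"
    using L(1) by (simp_all add: linkage_def)
  have labels: "\<exists>l\<in>{..length qs}. x \<in> slot X qs {z} l" if "x \<in> X \<union> E `` set qs" for x
    using slot_label_with_v0[OF that] by blast
  obtain a where a: "a \<in> {..length qs}" "hd L \<in> slot X qs {z} a"
    using labels[OF L'(2)] by blast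
  obtain b where b: "b \<in> {..length qs}" "last L \<in> slot X qs {z} b" "last L = v0 \<longrightarrow> b = 1"
    using slot_label_with_v0[OF L'(3)] by blast
  have steps: "successively (\<lambda>x y. link {X} x y \<or> x \<in> X \<union> E `` set qs \<and> y \<in> X \<union> E `` set qs) L"
    using L'(4) by (elim successively_mono) (auto simp: link_def)
  obtain ps where ps: "ps \<noteq> []" "glue ps = L" "target (last ps) = b"
    "\<And>p. p \<in> set ps \<Longrightarrow> fits (slot X qs {z}) (link {X}) p \<and> source p \<in> insert a {..length qs} \<and>
       target p \<in> insert b {..length qs}"
    "\<And>u v. sublist [u, v] L \<Longrightarrow> link {X} u v \<Longrightarrow> \<exists>p\<in>set ps. sublist [u, v] (content p)"
    using list_to_pieces[OF L'(1) steps a(2) b(2) labels] by blast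
  have "fits (slot X qs {z}) (link {X}) p \<and> source p \<le> length qs \<and> target p \<le> length qs"
    if "p \<in> set ps" for p
    using ps(4)[OF that] a(1) b(1) by auto
  moreover have "last ps \<in> set ps" "last (content (last ps)) = last L"
    using ps(1,2) ps(4)[of "last ps"] by (cases ps rule: rev_cases; auto simp: fits_def)+
  ultimately show ?thesis
    using ps(2,3) b(3) L(2,3) edge_at_content[OF _ ps(5)] by metis
qed

lemma lists_off_path:
  assumes below: "routes_below (card W)"
  shows "\<exists>Ls. enumerates Ls (W - set qs) \<and>
    (\<forall>L\<in>set Ls. linkage (X \<union> E `` set qs) (X \<union> E `` set qs) L \<and> (t \<in> set L \<longrightarrow> edge_at t L) \<and>
      (v0 \<in> set L \<longrightarrow> last L = v0))"
proof (rule enumerates_components)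
  show "finite (W - set qs)"
    using W by (simp add: anchored_to_def)
  show "\<exists>Ls. enumerates Ls (component (W - set qs) x) \<and>
      (\<forall>L\<in>set Ls. linkage (X \<union> E `` set qs) (X \<union> E `` set qs) L \<and> (t \<in> set L \<longrightarrow> edge_at t L) \<and>
        (v0 \<in> set L \<longrightarrow> last L = v0))" if "x \<in> W - set qs" for x
    using component_list[OF below that] by (metis empty_iff empty_set set_ConsD)
qed

lemma pieces_off_path:
  assumes below: "routes_below (card W)"
  obtains M p where "contents M = mset_set (W - set qs)" "labels M \<subseteq> {..length qs}"
    "\<And>p. p \<in># M \<Longrightarrow> fits (slot X qs {z}) (link {X}) p" "\<exists>p\<in>#M. edge_at t (content p)"
    "p \<in># M" "target p = 1" "last (content p) = v0"
proof -
  obtain Ls where Ls: "enumerates Ls (W - set qs)"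
    "\<And>L. L \<in> set Ls \<Longrightarrow> linkage (X \<union> E `` set qs) (X \<union> E `` set qs) L \<and> (t \<in> set L \<longrightarrow> edge_at t L) \<and>
        (v0 \<in> set L \<longrightarrow> last L = v0)"
    using lists_off_path[OF below] by blast
  define P where "P L ps \<longleftrightarrow>
      (\<forall>p\<in>set ps. fits (slot X qs {z}) (link {X}) p \<and> source p \<le> length qs \<and> target p \<le> length qs) \<and>
      (t \<in> set L \<longrightarrow> (\<exists>p\<in>set ps. edge_at t (content p))) \<and>
      (v0 \<in> set L \<longrightarrow> (\<exists>p\<in>set ps. target p = 1 \<and> last (content p) = v0))" for L ps
  have "\<exists>ps. glue ps = L \<and> P L ps" if "L \<in> set Ls" for L
    using Ls(2)[OF that] pieces_of_component_list unfolding P_def by blast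
  then obtain M where M: "contents M = mset (concat Ls)"
    "\<And>p. p \<in># M \<Longrightarrow> \<exists>L\<in>set Ls. \<exists>ps. P L ps \<and> p \<in> set ps"
    "\<And>L. L \<in> set Ls \<Longrightarrow> \<exists>ps. P L ps \<and> set ps \<subseteq> set_mset M"
    using choose_pieces[of Ls P] by blast
  have "contents M = mset_set (W - set qs)"
    using M(1) Ls(1) W by (simp add: mset_concat_eq_iff_enumerates anchored_to_def)
  moreover have "fits (slot X qs {z}) (link {X}) p" "{source p, target p} \<subseteq> {..length qs}" if "p \<in># M" for p
    using M(2)[OF that] by (auto simp: P_def)
  moreover from this(2) have "labels M \<subseteq> {..length qs}"
    unfolding labels_def by blast
  moreover have covered: "\<exists>L\<in>set Ls. v \<in> set L" if "v \<in> W - set qs" for v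
    using Ls(1) that by (auto simp: enumerates_def)
  have "\<exists>p\<in>#M. edge_at t (content p)"
    using covered[of t] M(3) t qs(5) unfolding P_def by fastforce
  moreover obtain p where "p \<in># M" "target p = 1" "last (content p) = v0"
    using covered[of v0] M(3) qs(3,5) unfolding P_def by fastforce
  ultimately show ?thesis
    using that by blast
qed

text \<open>Since \<open>v0\<close> fits both labels 0 and 1, the degree of the label 0 can be made odd.\<close>

lemma pieces_off_path_odd:
  assumes below: "routes_below (card W)"
  obtains M where "contents M = mset_set (W - set qs)" "labels M \<subseteq> {..length qs}"
    "\<And>p. p \<in># M \<Longrightarrow> fits (slot X qs {z}) (link {X}) p" "\<exists>p\<in>#M. edge_at t (content p)" "odd (deg 0 M)"
proof -
  obtain M p where M: "contents M = mset_set (W - set qs)" "labels M \<subseteq> {..length qs}"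
    "\<And>p. p \<in># M \<Longrightarrow> fits (slot X qs {z}) (link {X}) p" "\<exists>p\<in>#M. edge_at t (content p)"
    and p: "p \<in># M" "target p = 1" "last (content p) = v0"
    using pieces_off_path[OF below] by blast
  show ?thesis
  proof (cases "odd (deg 0 M)")
    case True
    then show ?thesis using that M by blast
  next
    case False
    obtain M' where M': "M = add_mset p M'"
      using p(1) by (metis insert_DiffM)
    define p' where "p' = Piece (source p) (content p) (0 :: nat)"
    have "fits (slot X qs {z}) (link {X}) p'"
      using M(3)[OF p(1)] p(3) v0(1) by (simp add: fits_def p'_def)
    moreover have "odd (deg 0 (add_mset p' M'))"
      using False p(2) by (simp add: M' p'_def)
    ultimately show ?thesis
      using that[of "add_mset p' M'"] M by (auto simp: M' p'_def)
  qed
qed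

lemma route_along_detour:
  assumes below: "routes_below (card W)"
  shows "\<exists>L. route W X z L \<and> edge_at t L"
proof -
  let ?m = "length qs"
  obtain M where M: "contents M = mset_set (W - set qs)" "labels M \<subseteq> {..?m}"
    "\<And>p. p \<in># M \<Longrightarrow> fits (slot X qs {z}) (link {X}) p" "\<exists>p\<in>#M. edge_at t (content p)" "odd (deg 0 M)"
    using pieces_off_path_odd[OF below] by blast
  have labels: "labels M \<subseteq> {..?m + 1}"
    using M(2) by auto
  have "deg (?m + 1) M = 0"
    using M(2) by (auto simp: deg_eq_0_iff)
  then have "odd (\<Sum>l=1..?m. deg l M)"
    using even_sum_deg_with_ends[OF labels] M(5) by simp
  moreover have "\<not> closed_under M {..0}"
    using even_sum_deg_if_closed_under[of "{..0}" M] M(5) by auto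
  ultimately obtain Q where Q: "Eulerian_spine (\<lambda>k. qs ! (k - 1)) ?m M Q" "0 \<notin> labels Q"
    using Eulerian_spine_cut[OF labels, of 0 "\<lambda>k. qs ! (k - 1)"] by auto
  have "deg 0 Q = 0"
    using Q(2) by (simp add: deg_eq_0_iff)
  then have odd: "odd (deg 0 (M + Q))"
    using M(5) by simp
  have "finite W" "distinct qs" "set qs \<subseteq> W" "last qs \<in> {z}" "0 \<in> labels Q \<Longrightarrow> hd qs \<in> X"
    using W qs Q(2) by (auto simp: anchored_to_def)
  moreover have "pairwise (link {X}) X" "pairwise (link {X}) {z}"
    by (simp_all add: pairwise_link)
  ultimately obtain Ls where Ls: "Ls \<noteq> []" "enumerates Ls W"
    "\<And>L. L \<in> set Ls \<Longrightarrow> L \<noteq> [] \<and> hd L \<in> X \<and> last L \<in> {z} \<and> successively (link {X}) L"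
    "\<And>p. p \<in># M \<Longrightarrow> \<exists>L\<in>set Ls. sublist (content p) L \<or> sublist (rev (content p)) L"
    "length Ls = 1"
    using cover_along_path[where R = "link {X}", OF _ _ _ qs(4) _ symp_link link_if_adj2 _ _ M(1) labels M(3) Q(1)]
      odd by metis
  then obtain L where L: "Ls = [L]"
    by (auto simp: length_Suc_conv)
  have "route W X z L"
    using Ls(2,3) by (simp add: L route_def enumerates_def)
  moreover have "edge_at t L"
    using M(4) Ls(4) edge_at_mono by (auto simp: L)
  ultimately show ?thesis by blast
qed

end

lemma route_if_detour:
  assumes below: "routes_below (card W)" and W: "anchored_to W X z" and t: "t \<in> W - {z}"
    and y: "y \<in> W - {z, t}" "(t, y) \<in> E" and v: "v \<in> X - {z}" "reach (W - {t, y}) v z"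
  shows "\<exists>L. route W X z L \<and> edge_at t L"
proof -
  obtain ps where ps: "ps \<noteq> []" "hd ps = v" "last ps = z" "distinct ps" "set ps \<subseteq> W - {t, y}" "walk ps"
    using v(2) by (rule reach_imp_walk)
  obtain qs where "ps = v # qs" "qs \<noteq> []"
    using ps(1-3) v(1) by (cases ps) (auto split: if_splits)
  then show ?thesis
    using route_along_detour[OF W _ _ y(2), of v qs] t y(1) v(1) ps below
    by (auto simp: successively_Cons)
qed

lemma route_if_no_detour:
  assumes below: "routes_below (card W)" and W: "anchored_to W X z" and t: "t \<in> W - {z}"
    and y: "y \<in> W - {z, t}" "(t, y) \<in> E" and v: "v \<in> X - {z}" "reach (W - {t}) z v"
    and no_detour: "\<And>x v. x \<in> W - {z, t} \<Longrightarrow> (t, x) \<in> E \<Longrightarrow> v \<in> X - {z} \<Longrightarrow> \<not> reach (W - {t, x}) v z"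
  shows "\<exists>L. route W X z L \<and> edge_at t L"
proof -
  obtain ps where ps: "ps \<noteq> []" "hd ps = z" "last ps = v" "distinct ps" "set ps \<subseteq> W - {t}" "walk ps"
    using v(2) by (rule reach_imp_walk)
  have neighbours: "x \<in> set ps" if x: "x \<in> W - {z, t}" "(t, x) \<in> E" for x
  proof (rule ccontr)
    assume "x \<notin> set ps"
    then have "set ps \<subseteq> W - {t, x}"
      using ps(5) by blast
    then have "reach (W - {t, x}) v z"
      using reach_mono[OF reach_if_walk[OF ps(6)]] ps(1-3) hd_in_set last_in_set by metis
    then show False
      using no_detour[OF x v(1)] by blast
  qed
  obtain r1 r2 where r: "ps = r1 @ y # r2"
    using split_list[OF neighbours[OF y]] by blast
  have "r1 \<noteq> []" "hd r1 = z" "last (y # r2) \<in> X"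
    using ps(2,3) r y(1) v(1) by (auto simp: hd_append split: if_splits)
  moreover have "component (W - {t, y}) z \<inter> X \<subseteq> {z}"
    using no_detour[OF y] reach_sym by (auto simp: component_def)
  ultimately show ?thesis
    using route_if_cut_by_edge[OF W t y(2), of r1 r2] ps(4-6) neighbours below
    unfolding r by blast
qed

theorem route_with_edge:
  assumes "anchored_to W X z" "t \<in> W - {z}"
  shows "\<exists>L. route W X z L \<and> edge_at t L"
  using assms
proof (induction "card W" arbitrary: W X z t rule: less_induct)
  case less
  have below: "routes_below (card W)"
    using less.hyps unfolding routes_below_def by blast
  note hyps = below less.prems
  consider (separated) "component (W - {t}) z \<inter> X \<subseteq> {z}" | (pendant) "E `` {t} \<inter> W \<subseteq> {z, t}"
    | (detour) y v where "y \<in> W - {z, t}" "(t, y) \<in> E" "v \<in> X - {z}" "reach (W - {t, y}) v z"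
    | (no_detour) y v where "y \<in> W - {z, t}" "(t, y) \<in> E" "v \<in> X - {z}" "reach (W - {t}) z v"
        "\<And>x v. x \<in> W - {z, t} \<Longrightarrow> (t, x) \<in> E \<Longrightarrow> v \<in> X - {z} \<Longrightarrow> \<not> reach (W - {t, x}) v z"
    unfolding component_def by blast
  then show ?case
  proof cases
    case separated
    then show ?thesis by (rule route_if_separated[OF hyps])
  next
    case pendant
    then show ?thesis by (rule route_if_pendant[OF less.prems])
  next
    case detour
    then show ?thesis by (rule route_if_detour[OF hyps])
  next
    case no_detour
    from no_detour(1-4) show ?thesis
      by (rule route_if_no_detour[OF hyps]) (rule no_detour(5))
  qed
qed

end

section \<open>Squares of 2-connected graphs\<close>

lemma graph_dist_le_2:
  assumes "pair_graph G" and "(u, v) \<in> parcs G \<union> parcs G O parcs G"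
  shows "graph_dist G u v \<le> 2"
proof -
  interpret pair_graph G by fact
  have "\<exists>p. awalk u p v \<and> length p \<le> 2"
    using assms(2)
  proof
    assume "(u, v) \<in> parcs G"
    then show ?thesis
      using in_arcsD1 by (intro exI[of _ "[(u, v)]"]) (simp add: awalk_def)
  next
    assume "(u, v) \<in> parcs G O parcs G"
    then obtain c where "(u, c) \<in> parcs G" "(c, v) \<in> parcs G" by blast
    then show ?thesis
      using in_arcsD1 by (intro exI[of _ "[(u, c), (c, v)]"]) (simp add: awalk_def)
  qed
  then obtain p where p: "awalk u p v" "length p \<le> 2" by blast
  have "awalk_cost (\<lambda>_. 1) p = real (length p)"
    by (induction p) auto
  then have "\<mu> (\<lambda>_. 1) u v \<le> real (length p)"
    using min_cost_le_walk_cost[OF p(1), of "\<lambda>_. 1"] by simp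
  also have "\<dots> \<le> ereal 2" using p(2) by simp
  finally show ?thesis by (simp add: graph_dist_def)
qed

lemma hamiltonian_path_of_list:
  assumes "P \<noteq> []" "distinct P" "set P = pverts G" "successively (\<lambda>x y. (x, y) \<in> parcs G) P"
  shows "hamiltonian_path G (hd P) (zip P (tl P)) (last P)"
proof -
  have "pawalk_verts (hd P) (zip P (tl P)) = P \<and> pcas (hd P) (zip P (tl P)) (last P) \<and>
      set (zip P (tl P)) \<subseteq> parcs G"
    using assms(1,4)
  proof (induction P rule: list_nonempty_induct)
    case (cons x xs)
    then show ?case by (cases xs) auto
  qed simp
  then show ?thesis
    using assms(1-3) hd_in_set[OF assms(1)]
    by (simp add: hamiltonian_path_def pre_digraph.apath_def pre_digraph.awalk_def
        cas_with_proj_eq awalk_verts_with_proj_eq)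
qed

lemma path_edges_of_sublist:
  assumes "sublist [a, b] P \<or> sublist [b, a] P"
  shows "{a, b} \<in> path_edges (zip P (tl P))"
proof -
  have "(c, d) \<in> set (zip P (tl P))" if "sublist [c, d] P" for c d
    using that
  proof (induction P)
    case (Cons x P)
    then show ?case by (cases P) (auto simp: sublist_Cons_right)
  qed simp
  then show ?thesis
    using assms unfolding path_edges_def by (force simp: insert_commute)
qed

lemma undirected_parcs:
  assumes "pair_graph G"
  shows "undirected (parcs G)"
proof
  interpret pair_graph G by fact
  show "sym (parcs G)"
    using arcs_symmetric by (intro symI)
qed

lemma hamiltonian_path_square:
  assumes "pair_graph G" "P \<noteq> []" "distinct P" "set P = pverts G"
    and "successively (undirected.adj2 (parcs G)) P"
  shows "hamiltonian_path (square G) (hd P) (zip P (tl P)) (last P)"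
proof (rule hamiltonian_path_of_list)
  interpret undirected "parcs G" by (rule undirected_parcs) fact
  have "successively (\<lambda>x y. x \<in> set P \<and> y \<in> set P \<and> x \<noteq> y \<and> adj2 x y) P"
    using assms(3,5) by (simp add: successively_conv_nth nth_eq_iff_index_eq)
  then show "successively (\<lambda>x y. (x, y) \<in> parcs (square G)) P"
    by (rule successively_mono)
      (use assms(4) graph_dist_le_2[OF assms(1)] in \<open>auto simp: square_def adj2_def\<close>)
qed (use assms in \<open>simp_all add: square_def\<close>)

lemma reachable_if_induced_connected:
  assumes "pair_graph G" "Digraph_Component.connected (with_proj G \<restriction> U)" "u \<in> U" "v \<in> U"
  shows "(u, v) \<in> rtrancl_on U (parcs G)"
proof -
  interpret pair_graph G by fact
  have "u \<rightarrow>\<^sup>*\<^bsub>mk_symmetric (with_proj G \<restriction> U)\<^esub> v"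
    using assms(2-4) by (auto simp: Digraph_Component.connected_def strongly_connected_def mk_symmetric_def)
  then have "(u, v) \<in> rtrancl_on U (parcs (mk_symmetric (with_proj G \<restriction> U)))"
    by (simp add: reachable_def mk_symmetric_def)
  moreover have "parcs (mk_symmetric (with_proj G \<restriction> U)) \<subseteq> parcs G"
    using arcs_symmetric by (auto simp: mk_symmetric_def)
  ultimately show ?thesis
    by (metis order.refl rtrancl_on_mono)
qed

lemma anchored_to_if_2_connected:
  assumes G: "pair_graph G" "k_connected 2 G" and V: "s \<in> pverts G" "z \<in> pverts G" "s \<noteq> z"
  shows "undirected.anchored_to (parcs G) (pverts G - {s}) (parcs G `` {s}) z"
proof -
  interpret pair_graph G by fact
  interpret undirected "parcs G" by (rule undirected_parcs) fact
  have reach: "reach (pverts G - {c}) u v" if "u \<in> pverts G - {c}" "v \<in> pverts G - {c}" for c u v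
  proof -
    have "card (pverts G \<inter> {c}) \<le> card {c}"
      by (intro card_mono) auto
    then have "Digraph_Component.connected (with_proj G \<restriction> (pverts G - pverts G \<inter> {c}))"
      using G(2) unfolding k_connected_def by auto
    moreover have "pverts G - pverts G \<inter> {c} = pverts G - {c}"
      by blast
    ultimately show ?thesis
      using reachable_if_induced_connected[OF G(1) _ that] by simp
  qed
  have "anchored (pverts G) {s, z}"
    unfolding anchored_def
  proof (intro allI ballI)
    fix c w assume "w \<in> pverts G - {c}"
    then show "\<exists>v\<in>{s, z}. reach (pverts G - {c}) w v"
      using reach[of w c] V by (cases "c = s") auto
  qed
  then have "anchored (pverts G - {s}) (insert z (parcs G `` {s}))"
    by (rule anchored_if_boundary_subset) blast+
  moreover have "connected_set (pverts G - {s})"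
    unfolding connected_set_def using reach by blast
  ultimately show ?thesis
    using V by (simp add: anchored_to_def)
qed

lemma square_list_with_edges:
  assumes G: "pair_graph G" "k_connected 2 G" and V: "{s, z, t} \<subseteq> pverts G" "s \<noteq> z" "s \<noteq> t" "z \<noteq> t"
  obtains P b c where "P \<noteq> []" "distinct P" "set P = pverts G" "successively (undirected.adj2 (parcs G)) P"
    "hd P = s" "last P = z" "(t, b) \<in> parcs G" "(s, c) \<in> parcs G" "{t, b} \<noteq> {s, c}"
    "sublist [t, b] P \<or> sublist [b, t] P" "sublist [s, c] P"
proof -
  interpret undirected "parcs G" by (rule undirected_parcs) fact
  have "anchored_to (pverts G - {s}) (parcs G `` {s}) z"
    using anchored_to_if_2_connected[OF G] V by simp
  then obtain L where L: "route (pverts G - {s}) (parcs G `` {s}) z L" "edge_at t L"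
    using route_with_edge[of _ _ z t] V by blast
  obtain b where b: "(t, b) \<in> parcs G" "sublist [t, b] L \<or> sublist [b, t] L"
    using L(2) by (auto simp: edge_at_def)
  have L': "L \<noteq> []" "distinct L" "set L = pverts G - {s}" "(s, hd L) \<in> parcs G" "last L = z"
    using L(1) by (simp_all add: route_def)
  have "successively adj2 L"
    using L(1) adj2_if_common_neighbour unfolding route_def
    by (auto elim!: successively_mono simp: link_def)
  then have "successively adj2 (s # L)"
    using L'(1,4) adj2_if_adjacent by (simp add: successively_Cons)
  moreover have "{t, b} \<noteq> {s, hd L}"
    using b(2) L'(3) V(3) set_mono_sublist[of "[t, b]" L] set_mono_sublist[of "[b, t]" L]
    by (auto simp: doubleton_eq_iff)
  moreover have "sublist [s, hd L] (s # L)"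
    using sublist_last_hd[of "[s]" L] L'(1) by simp
  moreover have "sublist [t, b] (s # L) \<or> sublist [b, t] (s # L)"
    using b(2) by (auto simp: sublist_Cons_right)
  ultimately show ?thesis
    using that[of "s # L" b "hd L"] L' b(1) V(1) by auto
qed

theorem theorem3:
  fixes G :: "'a pair_pre_digraph"
  assumes "pair_graph G" and "k_connected 2 G"
  shows "strong_F3 G"
  unfolding strong_F3_def
proof (intro allI impI ballI)
  interpret undirected "parcs G" by (rule undirected_parcs) fact
  fix x :: "nat \<Rightarrow> 'a" and i :: nat
  assume "x ` {1, 2, 3} \<subseteq> pverts G \<and> inj_on x {1, 2, 3}" and i: "i \<in> {1, 2}"
  then have "{x i, x (3 - i), x 3} \<subseteq> pverts G" "x i \<noteq> x (3 - i)" "x i \<noteq> x 3" "x (3 - i) \<noteq> x 3"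
    by (auto simp: inj_on_def)
  then obtain P z3 zi where P: "P \<noteq> []" "distinct P" "set P = pverts G" "successively adj2 P"
    "hd P = x i" "last P = x (3 - i)"
    and edges: "(x 3, z3) \<in> parcs G" "(x i, zi) \<in> parcs G" "{x 3, z3} \<noteq> {x i, zi}"
      "sublist [x 3, z3] P \<or> sublist [z3, x 3] P" "sublist [x i, zi] P"
    by (rule square_list_with_edges[OF assms])
  define P' where "P' = (if i = 1 then P else rev P)"
  have "hamiltonian_path (square G) (hd P') (zip P' (tl P')) (last P')"
    using P successively_rev_symp[of adj2 P] adj2_sym
    by (intro hamiltonian_path_square assms) (auto simp: P'_def symp_def simp del: successively_rev)
  moreover have "hd P' = x 1" "last P' = x 2"
    using P(1,5,6) i by (auto simp: P'_def hd_rev last_rev)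
  moreover have "{x 3, z3} \<in> path_edges (zip P' (tl P'))" "{x i, zi} \<in> path_edges (zip P' (tl P'))"
    using edges(4,5) sublist_rev[of "[_, _]" P] by (auto simp: P'_def intro!: path_edges_of_sublist)
  ultimately show "\<exists>p z3 zi. hamiltonian_path (square G) (x 1) p (x 2) \<and> (x 3, z3) \<in> parcs G \<and>
      (x i, zi) \<in> parcs G \<and> {x 3, z3} \<noteq> {x i, zi} \<and> {x 3, z3} \<in> path_edges p \<and> {x i, zi} \<in> path_edges p"
    using edges(1-3) by metis
qed

end
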